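(* Assume that the system states $\mathbf{q}_t=[\mathbf{r}_t,p_t]$ are i.i.d. over time $t\in\{0,1,2,\dots\}$ and that the storage is perfectly efficient ($\eta_i^+=\eta_i^-=1$ for all $i\in\mathcal{E}$). Let $w_t^*$ be the system cost at time slot $t$ under Algorithm 1 (defined in the context), let $w^*=\limsup_{T\to\infty}\frac1T\sum_{t=0}^{T-1}\mathbb{E}[w_t^*]$ be the resulting objective value of problem P1, and let $w^{\mathrm{opt}}$ be the optimal objective value of P1. Then: 1. $\displaystyle w^*-w^{\mathrm{opt}}\le \sum_{i\in\mathcal{E}}\frac{u_{i,\max}^2}{2V_i}$. 2. For every integer $T\ge 1$, $\displaystyle \frac1T\sum_{t=0}^{T-1}\mathbb{E}[w_t^*]-w^{\mathrm{opt}}\le \sum_{i\in\mathcal{E}}\left[\frac{u_{i,\max}^2}{2V_i}+\frac{\mathbb{E}[L(s_{i,0})]}{T V_i}\right]$, where $L(s_{i,t})=\frac12(s_{i,t}-\beta_i)^2$.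
   Context: Setting (ideal storage). There are $N\ge 2$ phases, and $\mathcal{E}\subseteq\{1,\dots,N\}$ is the set of phases with storage. Time is $t\in\{0,1,2,\dots\}$. Bold letters denote vectors over the $N$ phases. Random system state: $\mathbf{q}_t=[\mathbf{r}_t,p_t]$, with uncontrollable flows $r_{i,t}\in[r_{i,\min},r_{i,\max}]$ and price $p_t\in[p_{\min},p_{\max}]$. Control action: $\mathbf{a}_t=[\mathbf{l}_t,\mathbf{u}_t,\mathbf{f}_t]$, where $l_{i,t}\in\mathbb{R}$ is the controllable flow, $u_{i,t}$ the net charging amount (negative means discharging) and $f_{i,t}$ the flow between the substation and phase $i$. The set $\mathcal{F}\subset\mathbb{R}^N$ is non-empty, compact and convex. The functions $C_i,D_i,F:\mathbb{R}\to\mathbb{R}$ are convex and continuously differentiable. With $\overline{f}_t=\frac1N\sum_{j=1}^N f_{j,t}$, the system cost is $$w_t=\sum_{i\in\mathcal{E}}[p_tu_{i,t}+D_i(u_{i,t})]+\sum_{i=1}^N[C_i(l_{i,t})+F(f_{i,t}-\overline{f}_t)].$$ Problem P1: minimize $\limsup_{T\to\infty}\frac1T\sum_{t=0}^{T-1}\mathbb{E}[w_t]$ over control policies $\{\mathbf{a}_t\}$, subject for all $t$ to - $-u_{i,\max}\le u_{i,t}\le u_{i,\max}$ for $i\in\mathcal{E}$, and $u_{i,t}=0$ for $i\notin\mathcal{E}$; - $s_{i,t+1}=s_{i,t}+u_{i,t}$ and $s_{i,\min}\le s_{i,t}\le s_{i,\max}$ for $i\in\mathcal{E}$; - $\mathbf{f}_t\in\mathcal{F}$;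 - $f_{i,t}+r_{i,t}+l_{i,t}-u_{i,t}=0$ for all $i$. Policies may be randomized and are non-anticipative (no forecasts are available; only current and historical information is used). The initial energy states $s_{i,0}\in[s_{i,\min},s_{i,\max}]$ are exogenous, independent of the system-state process. Expectations are over the system states, the actions and the initial states. For $i\in\mathcal{E}$, $[D'_{i,\min},D'_{i,\max}]$ is the range of $D_i'$ on $[-u_{i,\max},u_{i,\max}]$, and $[C'_{i,\min},C'_{i,\max}]$ is the range of $C_i'$ over the feasible values of $l_i$, i.e. $l_i=u_i-f_i-r_i$ with $|u_i|\le u_{i,\max}$, $\mathbf{f}\in\mathcal{F}$, $r_i\in[r_{i,\min},r_{i,\max}]$. Parameters: for $i\in\mathcal{E}$, $$V_{i,\max}=\frac{s_{i,\max}-s_{i,\min}-2u_{i,\max}}{p_{\max}-p_{\min}+D'_{i,\max}-D'_{i,\min}+C'_{i,\max}-C'_{i,\min}},$$ where numerator and denominator are assumed positive, $V_i\in(0,V_{i,\max}]$, and $\beta_i=s_{i,\min}+u_{i,\max}+V_i(p_{\max}+D'_{i,\max}+C'_{i,\max})$. Algorithm 1: at each $t$, observe $\mathbf{q}_t$ and the energy states $s_{i,t}$; let $\mathbf{a}_t^*=[\mathbf{l}_t^*,\mathbf{u}_t^*,\mathbf{f}_t^*]$ be an optimal solution of the per-slot problem P3: minimize $w_t+\sum_{i\in\mathcal{E}}\frac{(s_{i,t}-\beta_i)u_{i,t}}{V_i}$ over $\mathbf{a}_t$ subject to $u_{i,t}=0$ for $i\notin\mathcal{E}$, $-u_{i,\max}\le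 u_{i,t}\le u_{i,\max}$ for $i\in\mathcal{E}$, $\mathbf{f}_t\in\mathcal{F}$, and $f_{i,t}+r_{i,t}+l_{i,t}-u_{i,t}=0$ for all $i$; then set $s_{i,t+1}=s_{i,t}+u_{i,t}^*$. *)

theory Defs
  imports "HOL-Probability.Probability"
begin

text \<open>
  The phases are the elements of a finite type; \<open>storage_phases\<close> is the set of phases equipped
  with storage.  Values of \<open>u_max\<close>, \<open>s_min\<close>, \<open>s_max\<close>, \<open>storage_cost\<close> at phases without
  storage are never used.
\<close>

record ('n::finite) network =
  storage_phases :: "'n set"
  r_min :: "'n \<Rightarrow> real"
  r_max :: "'n \<Rightarrow> real"
  p_min :: real
  p_max :: real
  u_max :: "'n \<Rightarrow> real"
  s_min :: "'n \<Rightarrow> real"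
  s_max :: "'n \<Rightarrow> real"
  flow_set :: "(real ^ 'n) set"
  ctrl_cost :: "'n \<Rightarrow> real \<Rightarrow> real"
  storage_cost :: "'n \<Rightarrow> real \<Rightarrow> real"
  deviation_cost :: "real \<Rightarrow> real"

text \<open>A system state is \<open>(r, p)\<close>; a control action is \<open>(l, u, f)\<close>.\<close>

type_synonym 'n state = "(real ^ 'n) \<times> real"
type_synonym 'n action = "(real ^ 'n) \<times> (real ^ 'n) \<times> (real ^ 'n)"

abbreviation uncontrolled :: "('n::finite) state \<Rightarrow> real ^ 'n" where "uncontrolled q \<equiv> fst q"
abbreviation price :: "('n::finite) state \<Rightarrow> real" where "price q \<equiv> snd q"
abbreviation controlled :: "('n::finite) action \<Rightarrow> real ^ 'n" where "controlled a \<equiv> fst a"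
abbreviation charging :: "('n::finite) action \<Rightarrow> real ^ 'n" where "charging a \<equiv> fst (snd a)"
abbreviation substation :: "('n::finite) action \<Rightarrow> real ^ 'n" where "substation a \<equiv> snd (snd a)"

definition mean_flow :: "real ^ ('n::finite) \<Rightarrow> real" where
  "mean_flow f = (\<Sum>j\<in>UNIV. f $ j) / real CARD('n)"

definition system_cost :: "('n::finite) network \<Rightarrow> 'n state \<Rightarrow> 'n action \<Rightarrow> real" where
  "system_cost S q a =
     (\<Sum>i\<in>storage_phases S. price q * charging a $ i + storage_cost S i (charging a $ i)) +
     (\<Sum>i\<in>UNIV. ctrl_cost S i (controlled a $ i)
              + deviation_cost S (substation a $ i - mean_flow (substation a)))"

definition state_bounds :: "('n::finite) network \<Rightarrow> 'n state \<Rightarrow> bool" where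
  "state_bounds S q \<longleftrightarrow>
     (\<forall>i. r_min S i \<le> uncontrolled q $ i \<and> uncontrolled q $ i \<le> r_max S i) \<and>
     p_min S \<le> price q \<and> price q \<le> p_max S"

definition energy_bounds :: "('n::finite) network \<Rightarrow> real ^ 'n \<Rightarrow> bool" where
  "energy_bounds S s \<longleftrightarrow> (\<forall>i\<in>storage_phases S. s_min S i \<le> s $ i \<and> s $ i \<le> s_max S i)"

definition slot_feasible :: "('n::finite) network \<Rightarrow> 'n state \<Rightarrow> 'n action \<Rightarrow> bool" where
  "slot_feasible S q a \<longleftrightarrow>
     (\<forall>i\<in>storage_phases S. - u_max S i \<le> charging a $ i \<and> charging a $ i \<le> u_max S i) \<and>
     (\<forall>i. i \<notin> storage_phases S \<longrightarrow> charging a $ i = 0) \<and>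
     substation a \<in> flow_set S \<and>
     (\<forall>i. substation a $ i + uncontrolled q $ i + controlled a $ i - charging a $ i = 0)"

text \<open>Energy states of perfectly efficient storage, driven by a sequence of actions.\<close>

primrec energy :: "real ^ ('n::finite) \<Rightarrow> (nat \<Rightarrow> 'n action) \<Rightarrow> nat \<Rightarrow> real ^ 'n" where
  "energy s a 0 = s"
| "energy s a (Suc t) = energy s a t + charging (a t)"


text \<open>
  Independence of two random variables that may take values in different types
  (\<open>indep_var\<close> of the library requires equal value types).
\<close>

definition indep_rv ::
  "'w measure \<Rightarrow> 'b measure \<Rightarrow> ('w \<Rightarrow> 'b) \<Rightarrow> 'c measure \<Rightarrow> ('w \<Rightarrow> 'c) \<Rightarrow> bool" where
  "indep_rv M N X K Y \<longleftrightarrow>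
     X \<in> measurable M N \<and> Y \<in> measurable M K \<and>
     prob_space.indep_set M {X -` A \<inter> space M | A. A \<in> sets N} {Y -` A \<inter> space M | A. A \<in> sets K}"

definition iid :: "'w measure \<Rightarrow> (nat \<Rightarrow> 'w \<Rightarrow> 'b::topological_space) \<Rightarrow> bool" where
  "iid M X \<longleftrightarrow>
     prob_space.indep_vars M (\<lambda>_. borel) X UNIV \<and>
     (\<forall>t. distr M borel (X t) = distr M borel (X 0))"

text \<open>
  The random environment: the initial energy states \<open>s0\<close>, the system states \<open>q\<close>, and
  auxiliary seeds \<open>\<xi>\<close> that policies use for randomization.  The seeds are independent,
  uniform on \<open>[0,1]\<close>, and independent of the pair of \<open>s0\<close> and \<open>q\<close>.
\<close>

definition random_environment ::
  "('n::finite) network \<Rightarrow> 'w measure \<Rightarrow> ('w \<Rightarrow> real ^ 'n) \<Rightarrow> (nat \<Rightarrow> 'w \<Rightarrow> 'n state) \<Rightarrow>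
   (nat \<Rightarrow> 'w \<Rightarrow> real) \<Rightarrow> bool" where
  "random_environment S M s0 q \<xi> \<longleftrightarrow>
     prob_space M \<and>
     iid M q \<and>
     (AE \<omega> in M. \<forall>t. state_bounds S (q t \<omega>)) \<and>
     indep_rv M borel s0 (PiM UNIV (\<lambda>_. borel)) (\<lambda>\<omega> t. q t \<omega>) \<and>
     (AE \<omega> in M. energy_bounds S (s0 \<omega>)) \<and>
     iid M \<xi> \<and>
     distr M borel (\<xi> 0) = uniform_measure lborel {0..1} \<and>
     indep_rv M (PiM UNIV (\<lambda>_. borel)) (\<lambda>\<omega> t. \<xi> t \<omega>)
       (borel \<Otimes>\<^sub>M PiM UNIV (\<lambda>_. borel)) (\<lambda>\<omega>. (s0 \<omega>, \<lambda>t. q t \<omega>))"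

text \<open>
  A randomized non-anticipative policy is represented by the action process it generates: the
  action at time \<open>t\<close> is a measurable function of the initial state, the system states and the
  seeds up to and including time \<open>t\<close>.  Past actions and energy states are functions of the same
  data, so closed-loop policies are included.
\<close>

definition history ::
  "('w \<Rightarrow> real ^ ('n::finite)) \<Rightarrow> (nat \<Rightarrow> 'w \<Rightarrow> 'n state) \<Rightarrow> (nat \<Rightarrow> 'w \<Rightarrow> real) \<Rightarrow> nat \<Rightarrow> 'w \<Rightarrow>
   (real ^ 'n) \<times> (nat \<Rightarrow> 'n state) \<times> (nat \<Rightarrow> real)" where
  "history s0 q \<xi> t \<omega> = (s0 \<omega>, (\<lambda>k\<in>{..t}. q k \<omega>), (\<lambda>k\<in>{..t}. \<xi> k \<omega>))"

definition nonanticipative ::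
  "'w measure \<Rightarrow> ('w \<Rightarrow> real ^ ('n::finite)) \<Rightarrow> (nat \<Rightarrow> 'w \<Rightarrow> 'n state) \<Rightarrow> (nat \<Rightarrow> 'w \<Rightarrow> real) \<Rightarrow>
   (nat \<Rightarrow> 'w \<Rightarrow> 'n action) \<Rightarrow> bool" where
  "nonanticipative M s0 q \<xi> a \<longleftrightarrow>
     (\<forall>t. \<exists>\<pi> \<in> borel_measurable
                 (borel \<Otimes>\<^sub>M PiM {..t} (\<lambda>_. borel) \<Otimes>\<^sub>M PiM {..t} (\<lambda>_. borel)).
        \<forall>\<omega>\<in>space M. a t \<omega> = \<pi> (history s0 q \<xi> t \<omega>))"

definition P1_feasible ::
  "('n::finite) network \<Rightarrow> 'w measure \<Rightarrow> ('w \<Rightarrow> real ^ 'n) \<Rightarrow> (nat \<Rightarrow> 'w \<Rightarrow> 'n state) \<Rightarrow>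
   (nat \<Rightarrow> 'w \<Rightarrow> real) \<Rightarrow> (nat \<Rightarrow> 'w \<Rightarrow> 'n action) \<Rightarrow> bool" where
  "P1_feasible S M s0 q \<xi> a \<longleftrightarrow>
     nonanticipative M s0 q \<xi> a \<and>
     (AE \<omega> in M. \<forall>t. slot_feasible S (q t \<omega>) (a t \<omega>) \<and>
                     energy_bounds S (energy (s0 \<omega>) (\<lambda>k. a k \<omega>) t))"

definition average_cost ::
  "('n::finite) network \<Rightarrow> 'w measure \<Rightarrow> (nat \<Rightarrow> 'w \<Rightarrow> 'n state) \<Rightarrow> (nat \<Rightarrow> 'w \<Rightarrow> 'n action) \<Rightarrow>
   nat \<Rightarrow> real" where
  "average_cost S M q a T = (1 / real T) * (\<Sum>t<T. LINT \<omega>|M. system_cost S (q t \<omega>) (a t \<omega>))"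

definition P1_objective ::
  "('n::finite) network \<Rightarrow> 'w measure \<Rightarrow> (nat \<Rightarrow> 'w \<Rightarrow> 'n state) \<Rightarrow> (nat \<Rightarrow> 'w \<Rightarrow> 'n action) \<Rightarrow>
   ereal" where
  "P1_objective S M q a = limsup (\<lambda>T. ereal (average_cost S M q a T))"

definition P1_optimum ::
  "('n::finite) network \<Rightarrow> 'w measure \<Rightarrow> ('w \<Rightarrow> real ^ 'n) \<Rightarrow> (nat \<Rightarrow> 'w \<Rightarrow> 'n state) \<Rightarrow>
   (nat \<Rightarrow> 'w \<Rightarrow> real) \<Rightarrow> ereal" where
  "P1_optimum S M s0 q \<xi> = (INF a\<in>{a. P1_feasible S M s0 q \<xi> a}. P1_objective S M q a)"


text \<open>
  Extreme marginal costs.  The images are compact under the standing assumptions, so \<open>Inf\<close> and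
  \<open>Sup\<close> are the minimum and the maximum.
\<close>

definition dD_min :: "('n::finite) network \<Rightarrow> 'n \<Rightarrow> real" where
  "dD_min S i = Inf (deriv (storage_cost S i) ` {- u_max S i .. u_max S i})"

definition dD_max :: "('n::finite) network \<Rightarrow> 'n \<Rightarrow> real" where
  "dD_max S i = Sup (deriv (storage_cost S i) ` {- u_max S i .. u_max S i})"

definition ctrl_range :: "('n::finite) network \<Rightarrow> 'n \<Rightarrow> real set" where
  "ctrl_range S i = {u - f $ i - r | u f r.
     \<bar>u\<bar> \<le> u_max S i \<and> f \<in> flow_set S \<and> r_min S i \<le> r \<and> r \<le> r_max S i}"

definition dC_min :: "('n::finite) network \<Rightarrow> 'n \<Rightarrow> real" where
  "dC_min S i = Inf (deriv (ctrl_cost S i) ` ctrl_range S i)"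

definition dC_max :: "('n::finite) network \<Rightarrow> 'n \<Rightarrow> real" where
  "dC_max S i = Sup (deriv (ctrl_cost S i) ` ctrl_range S i)"

definition V_num :: "('n::finite) network \<Rightarrow> 'n \<Rightarrow> real" where
  "V_num S i = s_max S i - s_min S i - 2 * u_max S i"

definition V_den :: "('n::finite) network \<Rightarrow> 'n \<Rightarrow> real" where
  "V_den S i = p_max S - p_min S + dD_max S i - dD_min S i + dC_max S i - dC_min S i"

definition V_max :: "('n::finite) network \<Rightarrow> 'n \<Rightarrow> real" where
  "V_max S i = V_num S i / V_den S i"

definition \<beta> :: "('n::finite) network \<Rightarrow> ('n \<Rightarrow> real) \<Rightarrow> 'n \<Rightarrow> real" where
  "\<beta> S V i = s_min S i + u_max S i + V i * (p_max S + dD_max S i + dC_max S i)"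

definition lyapunov :: "('n::finite) network \<Rightarrow> ('n \<Rightarrow> real) \<Rightarrow> 'n \<Rightarrow> real \<Rightarrow> real" where
  "lyapunov S V i s = (1 / 2) * (s - \<beta> S V i)\<^sup>2"

definition P3_objective ::
  "('n::finite) network \<Rightarrow> ('n \<Rightarrow> real) \<Rightarrow> real ^ 'n \<Rightarrow> 'n state \<Rightarrow> 'n action \<Rightarrow> real" where
  "P3_objective S V s q a =
     system_cost S q a + (\<Sum>i\<in>storage_phases S. (s $ i - \<beta> S V i) * charging a $ i / V i)"

definition P3_solution ::
  "('n::finite) network \<Rightarrow> ('n \<Rightarrow> real) \<Rightarrow> real ^ 'n \<Rightarrow> 'n state \<Rightarrow> 'n action \<Rightarrow> bool" where
  "P3_solution S V s q a \<longleftrightarrow> is_arg_min (P3_objective S V s q) (slot_feasible S q) a"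

text \<open>
  Minimizers of the per-slot problem need not be unique; ties may be broken by any
  non-anticipative, possibly randomized, rule.
\<close>

definition algorithm1 ::
  "('n::finite) network \<Rightarrow> ('n \<Rightarrow> real) \<Rightarrow> 'w measure \<Rightarrow> ('w \<Rightarrow> real ^ 'n) \<Rightarrow>
   (nat \<Rightarrow> 'w \<Rightarrow> 'n state) \<Rightarrow> (nat \<Rightarrow> 'w \<Rightarrow> real) \<Rightarrow> (nat \<Rightarrow> 'w \<Rightarrow> 'n action) \<Rightarrow> bool" where
  "algorithm1 S V M s0 q \<xi> a \<longleftrightarrow>
     nonanticipative M s0 q \<xi> a \<and>
     (AE \<omega> in M. \<forall>t. P3_solution S V (energy (s0 \<omega>) (\<lambda>k. a k \<omega>) t) (q t \<omega>) (a t \<omega>))"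

end

theory Submission
  imports Defs
begin

text \<open>
  Let \<open>G s\<close> be the expected optimal value of the per-slot problem with frozen storage level \<open>s\<close>.
  For any policy feasible for P1, averaging its per-slot objectives with weights frozen at \<open>s\<close>
  telescopes the charging amounts into bounded storage levels, so \<open>G s\<close> is at most its average
  cost; hence \<open>G s\<close> is a lower bound for the optimum, uniformly in \<open>s\<close>.  Under Algorithm 1 the
  storage level is independent of the current system state, so conditioning on it bounds the
  expected per-slot objective by the optimum.  That objective is the system cost plus the Lyapunov
  drift up to \<open>u\<^sup>2 / (2 V)\<close>, and summing over time gives both bounds.
\<close>

section \<open>Independence\<close>

text \<open>Comparing with \<open>G s\<close> makes it unnecessary to construct an optimal
  stationary randomized policy. The weight \<open>s\<close> is deterministic, so an arbitrary
  history-dependent policy is compared with the per-slot optimum outcome by outcome, without any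
  independence of its actions from the states. Independence enters only for Algorithm 1, whose
  weight is the random storage level. The obstacle there is measure-theoretic: the optimal per-slot
  value is an infimum over uncountably many actions, yet it must be jointly measurable in level and
  state and then be integrated over the state with the level held fixed. Solving the balance
  equation for the controllable flow leaves a compact set of choices that does not depend on the
  state, and the infimum reduces to a countable one. Integration at a fixed level is Fubini for a
  joint law, so independence is needed as equality of that law with a product. The constant
  \<open>u\<^sup>2 / (2 V)\<close> is the second-order remainder in the expansion of
  \<open>(s + u - \<beta>)\<^sup>2 / 2\<close>, divided by \<open>V\<close>.\<close>

lemma (in prob_space) indep_rv_iff_prob:
  "indep_rv M N X K Y \<longleftrightarrow> X \<in> measurable M N \<and> Y \<in> measurable M K \<and>
     (\<forall>A\<in>sets N. \<forall>B\<in>sets K. prob ((X -` A \<inter> space M) \<inter> (Y -` B \<inter> space M))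
        = prob (X -` A \<inter> space M) * prob (Y -` B \<inter> space M))"
proof
  assume "indep_rv M N X K Y"
  then have X: "X \<in> measurable M N" and Y: "Y \<in> measurable M K"
    and i: "indep_set {X -` A \<inter> space M | A. A \<in> sets N} {Y -` A \<inter> space M | A. A \<in> sets K}"
    unfolding indep_rv_def by auto
  have "prob ((X -` A \<inter> space M) \<inter> (Y -` B \<inter> space M))
        = prob (X -` A \<inter> space M) * prob (Y -` B \<inter> space M)" if "A \<in> sets N" "B \<in> sets K" for A B
    by (rule indep_setD[OF i]) (use that in auto)
  with X Y show "X \<in> measurable M N \<and> Y \<in> measurable M K \<and>
     (\<forall>A\<in>sets N. \<forall>B\<in>sets K. prob ((X -` A \<inter> space M) \<inter> (Y -` B \<inter> space M))
        = prob (X -` A \<inter> space M) * prob (Y -` B \<inter> space M))"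
    by blast
next
  assume *: "X \<in> measurable M N \<and> Y \<in> measurable M K \<and>
     (\<forall>A\<in>sets N. \<forall>B\<in>sets K. prob ((X -` A \<inter> space M) \<inter> (Y -` B \<inter> space M))
        = prob (X -` A \<inter> space M) * prob (Y -` B \<inter> space M))"
  then have "indep_set {X -` A \<inter> space M | A. A \<in> sets N} {Y -` A \<inter> space M | A. A \<in> sets K}"
    by (intro indep_setI) auto
  with * show "indep_rv M N X K Y"
    unfolding indep_rv_def by blast
qed

text \<open>Rectangles determine a product of probability measures, and on
  \<open>A \<times> B\<close> the joint law and the product of the laws are the two sides of the
  product rule for events. The form with laws is the one to which Fubini applies.\<close>

lemma (in prob_space) indep_rv_iff_distr:
  "indep_rv M N X K Y \<longleftrightarrow> X \<in> measurable M N \<and> Y \<in> measurable M K \<and>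
     distr M (N \<Otimes>\<^sub>M K) (\<lambda>\<omega>. (X \<omega>, Y \<omega>)) = distr M N X \<Otimes>\<^sub>M distr M K Y"
proof (cases "X \<in> measurable M N \<and> Y \<in> measurable M K")
  case True
  then have X[measurable]: "X \<in> measurable M N" and Y[measurable]: "Y \<in> measurable M K" by auto
  interpret X: prob_space "distr M N X" by (rule prob_space_distr) fact
  interpret Y: prob_space "distr M K Y" by (rule prob_space_distr) fact
  have pair: "emeasure (distr M (N \<Otimes>\<^sub>M K) (\<lambda>\<omega>. (X \<omega>, Y \<omega>))) (A \<times> B)
      = ennreal (prob ((X -` A \<inter> space M) \<inter> (Y -` B \<inter> space M)))"
    if "A \<in> sets N" "B \<in> sets K" for A B
  proof -
    have "emeasure (distr M (N \<Otimes>\<^sub>M K) (\<lambda>\<omega>. (X \<omega>, Y \<omega>))) (A \<times> B)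
      = emeasure M ((\<lambda>\<omega>. (X \<omega>, Y \<omega>)) -` (A \<times> B) \<inter> space M)"
      using that by (subst emeasure_distr) auto
    also have "(\<lambda>\<omega>. (X \<omega>, Y \<omega>)) -` (A \<times> B) \<inter> space M = (X -` A \<inter> space M) \<inter> (Y -` B \<inter> space M)"
      by auto
    finally show ?thesis by (simp add: emeasure_eq_measure)
  qed
  have prod: "emeasure (distr M N X) A * emeasure (distr M K Y) B
      = ennreal (prob (X -` A \<inter> space M) * prob (Y -` B \<inter> space M))"
    if "A \<in> sets N" "B \<in> sets K" for A B
    using that by (simp add: emeasure_distr emeasure_eq_measure ennreal_mult)
  show ?thesis
  proof
    assume "indep_rv M N X K Y"
    then have i: "\<forall>A\<in>sets N. \<forall>B\<in>sets K. prob ((X -` A \<inter> space M) \<inter> (Y -` B \<inter> space M))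
        = prob (X -` A \<inter> space M) * prob (Y -` B \<inter> space M)"
      by (simp add: indep_rv_iff_prob)
    have "distr M N X \<Otimes>\<^sub>M distr M K Y = distr M (N \<Otimes>\<^sub>M K) (\<lambda>\<omega>. (X \<omega>, Y \<omega>))"
    proof (rule pair_measure_eqI)
      fix A B assume "A \<in> sets (distr M N X)" "B \<in> sets (distr M K Y)"
      then have AB: "A \<in> sets N" "B \<in> sets K" by auto
      show "emeasure (distr M N X) A * emeasure (distr M K Y) B
        = emeasure (distr M (N \<Otimes>\<^sub>M K) (\<lambda>\<omega>. (X \<omega>, Y \<omega>))) (A \<times> B)"
        using i AB by (simp add: pair[OF AB] prod[OF AB])
    qed (auto intro: X.sigma_finite_measure_axioms Y.sigma_finite_measure_axioms cong: sets_pair_measure_cong)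
    with X Y show "X \<in> measurable M N \<and> Y \<in> measurable M K \<and>
       distr M (N \<Otimes>\<^sub>M K) (\<lambda>\<omega>. (X \<omega>, Y \<omega>)) = distr M N X \<Otimes>\<^sub>M distr M K Y" by simp
  next
    assume d: "X \<in> measurable M N \<and> Y \<in> measurable M K \<and>
       distr M (N \<Otimes>\<^sub>M K) (\<lambda>\<omega>. (X \<omega>, Y \<omega>)) = distr M N X \<Otimes>\<^sub>M distr M K Y"
    have "prob ((X -` A \<inter> space M) \<inter> (Y -` B \<inter> space M))
        = prob (X -` A \<inter> space M) * prob (Y -` B \<inter> space M)"
      if AB: "A \<in> sets N" "B \<in> sets K" for A B
    proof -
      have "ennreal (prob ((X -` A \<inter> space M) \<inter> (Y -` B \<inter> space M)))
        = emeasure (distr M N X \<Otimes>\<^sub>M distr M K Y) (A \<times> B)"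
        using d pair[OF AB] by simp
      also have "\<dots> = ennreal (prob (X -` A \<inter> space M) * prob (Y -` B \<inter> space M))"
        using AB by (subst Y.emeasure_pair_measure_Times) (simp_all add: prod[OF AB])
      finally show ?thesis by simp
    qed
    with d show "indep_rv M N X K Y" by (simp add: indep_rv_iff_prob)
  qed
qed (auto simp: indep_rv_iff_prob)

lemma (in prob_space) indep_rv_compose:
  assumes i: "indep_rv M N X K Y" and f: "f \<in> measurable N N'" and g: "g \<in> measurable K K'"
  shows "indep_rv M N' (\<lambda>\<omega>. f (X \<omega>)) K' (\<lambda>\<omega>. g (Y \<omega>))"
proof -
  have X: "X \<in> measurable M N" and Y: "Y \<in> measurable M K"
    and p: "\<And>A B. A \<in> sets N \<Longrightarrow> B \<in> sets K \<Longrightarrow> prob ((X -` A \<inter> space M) \<inter> (Y -` B \<inter> space M))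
        = prob (X -` A \<inter> space M) * prob (Y -` B \<inter> space M)"
    using i by (auto simp: indep_rv_iff_prob)
  have *: "(\<lambda>\<omega>. f (X \<omega>)) -` A \<inter> space M = X -` (f -` A \<inter> space N) \<inter> space M" for A
    using measurable_space[OF X] by auto
  have **: "(\<lambda>\<omega>. g (Y \<omega>)) -` A \<inter> space M = Y -` (g -` A \<inter> space K) \<inter> space M" for A
    using measurable_space[OF Y] by auto
  have "prob (((\<lambda>\<omega>. f (X \<omega>)) -` A \<inter> space M) \<inter> ((\<lambda>\<omega>. g (Y \<omega>)) -` B \<inter> space M))
      = prob ((\<lambda>\<omega>. f (X \<omega>)) -` A \<inter> space M) * prob ((\<lambda>\<omega>. g (Y \<omega>)) -` B \<inter> space M)"
    if "A \<in> sets N'" "B \<in> sets K'" for A B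
    unfolding * ** by (rule p) (use that f g in \<open>auto intro: measurable_sets\<close>)
  with X Y f g show ?thesis
    unfolding indep_rv_iff_prob by (blast intro: measurable_compose)
qed

text \<open>Associativity of the product measure, read as a statement on independence. It lets
  independence from \<open>Y\<close> be extended by one variable at a time: later the initial
  levels, and then the seeds, are attached to the past states in this way.\<close>

lemma (in prob_space) indep_rv_assoc:
  assumes ZXY: "indep_rv M L Z (N \<Otimes>\<^sub>M K) (\<lambda>\<omega>. (X \<omega>, Y \<omega>))"
    and XY: "indep_rv M N X K Y"
  shows "indep_rv M (L \<Otimes>\<^sub>M N) (\<lambda>\<omega>. (Z \<omega>, X \<omega>)) K Y"
proof -
  have Z[measurable]: "Z \<in> measurable M L" and X[measurable]: "X \<in> measurable M N"
    and Y[measurable]: "Y \<in> measurable M K"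
    and dXY: "distr M (N \<Otimes>\<^sub>M K) (\<lambda>\<omega>. (X \<omega>, Y \<omega>)) = distr M N X \<Otimes>\<^sub>M distr M K Y"
    using XY ZXY by (auto simp: indep_rv_iff_distr)
  have dZXY: "distr M (L \<Otimes>\<^sub>M (N \<Otimes>\<^sub>M K)) (\<lambda>\<omega>. (Z \<omega>, X \<omega>, Y \<omega>))
      = distr M L Z \<Otimes>\<^sub>M distr M (N \<Otimes>\<^sub>M K) (\<lambda>\<omega>. (X \<omega>, Y \<omega>))"
    using ZXY by (auto simp: indep_rv_iff_distr)
  have ZX: "indep_rv M L Z N X"
    using indep_rv_compose[OF ZXY measurable_id measurable_fst] by (simp add: id_def)
  then have dZX: "distr M (L \<Otimes>\<^sub>M N) (\<lambda>\<omega>. (Z \<omega>, X \<omega>)) = distr M L Z \<Otimes>\<^sub>M distr M N X"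
    by (simp add: indep_rv_iff_distr)
  interpret X: prob_space "distr M N X" by (rule prob_space_distr) fact
  interpret Y: prob_space "distr M K Y" by (rule prob_space_distr) fact
  interpret Z: prob_space "distr M L Z" by (rule prob_space_distr) fact
  interpret XY: prob_space "distr M (N \<Otimes>\<^sub>M K) (\<lambda>\<omega>. (X \<omega>, Y \<omega>))" by (rule prob_space_distr) simp
  interpret ZX: prob_space "distr M (L \<Otimes>\<^sub>M N) (\<lambda>\<omega>. (Z \<omega>, X \<omega>))" by (rule prob_space_distr) simp
  have "distr M (L \<Otimes>\<^sub>M N) (\<lambda>\<omega>. (Z \<omega>, X \<omega>)) \<Otimes>\<^sub>M distr M K Y
      = distr M ((L \<Otimes>\<^sub>M N) \<Otimes>\<^sub>M K) (\<lambda>\<omega>. ((Z \<omega>, X \<omega>), Y \<omega>))"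
  proof (rule pair_measure_eqI)
    fix A B assume "A \<in> sets (distr M (L \<Otimes>\<^sub>M N) (\<lambda>\<omega>. (Z \<omega>, X \<omega>)))" "B \<in> sets (distr M K Y)"
    then have A[measurable]: "A \<in> sets (L \<Otimes>\<^sub>M N)" and B[measurable]: "B \<in> sets K" by auto
    \<comment> \<open>\<open>E\<close> is the rectangle \<open>A \<times> B\<close> with its
      coordinates re-bracketed. Its section at \<open>z\<close> is again a rectangle, the section of
      \<open>A\<close> times \<open>B\<close>, so the law of \<open>Y\<close> factors out of the
      integral over \<open>z\<close>.\<close>
    define E where "E = (\<lambda>(z, x, y). ((z, x), y)) -` (A \<times> B) \<inter> space (L \<Otimes>\<^sub>M (N \<Otimes>\<^sub>M K))"
    have E[measurable]: "E \<in> sets (L \<Otimes>\<^sub>M (N \<Otimes>\<^sub>M K))"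
      unfolding E_def by (rule measurable_sets[of _ _ "(L \<Otimes>\<^sub>M N) \<Otimes>\<^sub>M K"]) auto
    have sec: "Pair z -` E = (Pair z -` A) \<times> B" if "z \<in> space L" for z
      using that sets.sets_into_space[OF A] sets.sets_into_space[OF B]
      by (auto simp: E_def space_pair_measure)
    have "emeasure (distr M ((L \<Otimes>\<^sub>M N) \<Otimes>\<^sub>M K) (\<lambda>\<omega>. ((Z \<omega>, X \<omega>), Y \<omega>))) (A \<times> B)
        = emeasure M ((\<lambda>\<omega>. ((Z \<omega>, X \<omega>), Y \<omega>)) -` (A \<times> B) \<inter> space M)"
      by (rule emeasure_distr) auto
    also have "(\<lambda>\<omega>. ((Z \<omega>, X \<omega>), Y \<omega>)) -` (A \<times> B) \<inter> space M
        = (\<lambda>\<omega>. (Z \<omega>, X \<omega>, Y \<omega>)) -` E \<inter> space M"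
      using measurable_space[OF Z] measurable_space[OF X] measurable_space[OF Y]
      by (auto simp: E_def space_pair_measure)
    also have "emeasure M \<dots> = emeasure (distr M (L \<Otimes>\<^sub>M (N \<Otimes>\<^sub>M K)) (\<lambda>\<omega>. (Z \<omega>, X \<omega>, Y \<omega>))) E"
      by (rule emeasure_distr[symmetric]) auto
    also have "\<dots> = (\<integral>\<^sup>+z. emeasure (distr M (N \<Otimes>\<^sub>M K) (\<lambda>\<omega>. (X \<omega>, Y \<omega>))) (Pair z -` E) \<partial>distr M L Z)"
      unfolding dZXY
      by (rule XY.emeasure_pair_measure_alt) (simp cong: sets_pair_measure_cong)
    also have "\<dots> = (\<integral>\<^sup>+z. emeasure (distr M N X) (Pair z -` A) * emeasure (distr M K Y) B \<partial>distr M L Z)"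
    proof (rule nn_integral_cong)
      fix z assume "z \<in> space (distr M L Z)"
      then have "z \<in> space L" by simp
      then show "emeasure (distr M (N \<Otimes>\<^sub>M K) (\<lambda>\<omega>. (X \<omega>, Y \<omega>))) (Pair z -` E)
        = emeasure (distr M N X) (Pair z -` A) * emeasure (distr M K Y) B"
        unfolding dXY sec[OF \<open>z \<in> space L\<close>]
        by (intro Y.emeasure_pair_measure_Times) (auto intro: sets_Pair1)
    qed
    also have "\<dots> = (\<integral>\<^sup>+z. emeasure (distr M N X) (Pair z -` A) \<partial>distr M L Z) * emeasure (distr M K Y) B"
      by (rule nn_integral_multc) (rule X.measurable_emeasure_Pair, simp cong: sets_pair_measure_cong)
    also have "(\<integral>\<^sup>+z. emeasure (distr M N X) (Pair z -` A) \<partial>distr M L Z)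
        = emeasure (distr M L Z \<Otimes>\<^sub>M distr M N X) A"
      by (rule X.emeasure_pair_measure_alt[symmetric]) (simp cong: sets_pair_measure_cong)
    finally show "emeasure (distr M (L \<Otimes>\<^sub>M N) (\<lambda>\<omega>. (Z \<omega>, X \<omega>))) A * emeasure (distr M K Y) B
        = emeasure (distr M ((L \<Otimes>\<^sub>M N) \<Otimes>\<^sub>M K) (\<lambda>\<omega>. ((Z \<omega>, X \<omega>), Y \<omega>))) (A \<times> B)"
      by (simp add: dZX)
  qed (auto intro: ZX.sigma_finite_measure_axioms Y.sigma_finite_measure_axioms cong: sets_pair_measure_cong)
  then show ?thesis
    by (simp add: indep_rv_iff_distr)
qed

text \<open>Fubini in place of conditional expectations: under the product law the inner integral
  over \<open>Y\<close>, with \<open>x\<close> frozen, is at most \<open>J\<close>, and averaging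
  over the law of \<open>X\<close> keeps the bound.\<close>

lemma (in prob_space) expectation_le_of_indep_rv:
  fixes \<phi> :: "'b \<times> 'c \<Rightarrow> real"
  assumes i: "indep_rv M N X K Y" and m[measurable]: "\<phi> \<in> borel_measurable (N \<Otimes>\<^sub>M K)"
    and int: "integrable M (\<lambda>\<omega>. \<phi> (X \<omega>, Y \<omega>))"
    and le: "\<And>x. x \<in> space N \<Longrightarrow> expectation (\<lambda>\<omega>. \<phi> (x, Y \<omega>)) \<le> J"
  shows "expectation (\<lambda>\<omega>. \<phi> (X \<omega>, Y \<omega>)) \<le> J"
proof -
  have X[measurable]: "X \<in> measurable M N" and Y[measurable]: "Y \<in> measurable M K"
    and d: "distr M (N \<Otimes>\<^sub>M K) (\<lambda>\<omega>. (X \<omega>, Y \<omega>)) = distr M N X \<Otimes>\<^sub>M distr M K Y"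
    using i by (auto simp: indep_rv_iff_distr)
  interpret X: prob_space "distr M N X" by (rule prob_space_distr) fact
  interpret Y: prob_space "distr M K Y" by (rule prob_space_distr) fact
  interpret P: pair_sigma_finite "distr M N X" "distr M K Y" ..
  have int': "integrable (distr M N X \<Otimes>\<^sub>M distr M K Y) \<phi>"
    using int unfolding d[symmetric] by (simp add: integrable_distr_eq)
  have "expectation (\<lambda>\<omega>. \<phi> (X \<omega>, Y \<omega>)) = integral\<^sup>L (distr M N X \<Otimes>\<^sub>M distr M K Y) \<phi>"
    unfolding d[symmetric] by (subst integral_distr) auto
  also have "\<dots> = (\<integral>x. (\<integral>y. \<phi> (x, y) \<partial>distr M K Y) \<partial>distr M N X)"
    using P.integral_fst'[OF int'] by simp
  also have "\<dots> \<le> J"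
  proof (rule X.integral_le_const)
    show "integrable (distr M N X) (\<lambda>x. \<integral>y. \<phi> (x, y) \<partial>distr M K Y)"
      by (rule P.integrable_fst'[OF int'])
    show "AE x in distr M N X. (\<integral>y. \<phi> (x, y) \<partial>distr M K Y) \<le> J"
    proof (rule AE_I2)
      fix x assume "x \<in> space (distr M N X)"
      then have x: "x \<in> space N" by simp
      have [measurable]: "(\<lambda>y. \<phi> (x, y)) \<in> borel_measurable K"
        using x by (intro measurable_compose[OF measurable_Pair1' m])
      show "(\<integral>y. \<phi> (x, y) \<partial>distr M K Y) \<le> J"
        using le[OF x] by (subst integral_distr) auto
    qed
  qed
  finally show ?thesis .
qed

section \<open>The per-slot problem\<close>

lemma energy_eq_sum: "energy s a t = s + (\<Sum>k<t. charging (a k))"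
  by (induction t) (auto simp: add.assoc)

text \<open>The balance equation determines the controllable flow, so only charging and substation
  flow remain to be chosen. Unlike the set of feasible actions, this set does not depend on the
  state.\<close>

definition decisions :: "('n::finite) network \<Rightarrow> ((real ^ 'n) \<times> (real ^ 'n)) set" where
  "decisions S = {u. (\<forall>i\<in>storage_phases S. - u_max S i \<le> u $ i \<and> u $ i \<le> u_max S i) \<and>
     (\<forall>i. i \<notin> storage_phases S \<longrightarrow> u $ i = 0)} \<times> flow_set S"

definition balancing_action :: "('n::finite) state \<Rightarrow> (real ^ 'n) \<times> (real ^ 'n) \<Rightarrow> 'n action" where
  "balancing_action q x = (fst x - snd x - uncontrolled q, fst x, snd x)"

lemma slot_feasible_iff:
  "slot_feasible S q a \<longleftrightarrow> (\<exists>x\<in>decisions S. a = balancing_action q x)"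
proof
  assume f: "slot_feasible S q a"
  have "controlled a $ i = charging a $ i - substation a $ i - uncontrolled q $ i" for i
  proof -
    have "substation a $ i + uncontrolled q $ i + controlled a $ i - charging a $ i = 0"
      using f by (simp add: slot_feasible_def)
    then show ?thesis by linarith
  qed
  then have "a = balancing_action q (charging a, substation a)"
    by (auto simp: balancing_action_def prod_eq_iff vec_eq_iff)
  moreover have "(charging a, substation a) \<in> decisions S"
    using f unfolding decisions_def slot_feasible_def by blast
  ultimately show "\<exists>x\<in>decisions S. a = balancing_action q x" by blast
qed (auto simp: slot_feasible_def decisions_def balancing_action_def)

locale storage_system =
  fixes S :: "('n::finite) network" and V :: "'n \<Rightarrow> real"
  assumes compact_flow_set: "compact (flow_set S)"
    and flow_set_nonempty: "flow_set S \<noteq> {}"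
    and continuous_ctrl_cost: "\<And>i. continuous_on UNIV (ctrl_cost S i)"
    and continuous_storage_cost:
      "\<And>i. i \<in> storage_phases S \<Longrightarrow> continuous_on UNIV (storage_cost S i)"
    and continuous_deviation_cost: "continuous_on UNIV (deviation_cost S)"
    and V_pos: "\<And>i. i \<in> storage_phases S \<Longrightarrow> V i > 0"
    and u_max_nonneg: "\<And>i. i \<in> storage_phases S \<Longrightarrow> u_max S i \<ge> 0"
begin

section \<open>Continuity, compactness and uniform bounds\<close>

lemma continuous_on_system_cost:
  "continuous_on UNIV (\<lambda>z. system_cost S (fst z) (snd z))"
  unfolding system_cost_def mean_flow_def
  by (intro continuous_intros continuous_on_compose2[OF continuous_ctrl_cost]
      continuous_on_compose2[OF continuous_storage_cost]
      continuous_on_compose2[OF continuous_deviation_cost]) auto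

text \<open>Joint continuity serves twice: at a fixed level and state it supports the compactness
  arguments over decisions, and at a fixed decision it gives measurability in level and
  state.\<close>

lemma continuous_on_P3_objective:
  "continuous_on UNIV (\<lambda>z. P3_objective S V (fst z) (fst (snd z)) (balancing_action (fst (snd z)) (snd (snd z))))"
  unfolding P3_objective_def balancing_action_def
  by (intro continuous_intros continuous_on_compose2[OF continuous_on_system_cost, where f="\<lambda>z. (_ z, _ z)", simplified])
     (use V_pos in \<open>auto simp: less_imp_neq[symmetric]\<close>)

lemma compact_decisions: "compact (decisions S)"
proof -
  \<comment> \<open>Phases without storage get the degenerate side \<open>[0, 0]\<close>, so that
    all charging constraints together form one box.\<close>
  let ?b = "\<chi> i. if i \<in> storage_phases S then u_max S i else 0"
  have "{u. (\<forall>i\<in>storage_phases S. - u_max S i \<le> u $ i \<and> u $ i \<le> u_max S i) \<and>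
     (\<forall>i. i \<notin> storage_phases S \<longrightarrow> u $ i = 0)} = cbox (- ?b) ?b"
    (is "?U = _")
  proof (intro set_eqI iffI)
    fix u assume "u \<in> cbox (- ?b) ?b"
    then have box: "- ?b $ i \<le> u $ i \<and> u $ i \<le> ?b $ i" for i
      by (simp add: mem_box_cart)
    have "i \<in> storage_phases S \<Longrightarrow> - u_max S i \<le> u $ i \<and> u $ i \<le> u_max S i"
      and "i \<notin> storage_phases S \<Longrightarrow> u $ i = 0" for i
      using box[of i] by auto
    then show "u \<in> ?U" by blast
  qed (auto simp: mem_box_cart)
  then show ?thesis
    unfolding decisions_def by (simp add: compact_Times compact_cbox compact_flow_set)
qed

lemma decisions_nonempty: "decisions S \<noteq> {}"
proof -
  obtain f where "f \<in> flow_set S" using flow_set_nonempty by blast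
  then have "(0, f) \<in> decisions S" using u_max_nonneg by (auto simp: decisions_def)
  then show ?thesis by blast
qed

lemma abs_charging_le:
  assumes "slot_feasible S q a" "i \<in> storage_phases S"
  shows "\<bar>charging a $ i\<bar> \<le> u_max S i"
  using assms by (auto simp: slot_feasible_def abs_le_iff minus_le_iff)

text \<open>Bounded states and decisions form a compact product on which the cost is continuous. One
  constant serves all slots and outcomes, hence both integrability in each slot and a bound on time
  averages that is uniform in the horizon.\<close>

lemma system_cost_bounded:
  obtains C where "C \<ge> 0"
    "\<And>q a. state_bounds S q \<Longrightarrow> slot_feasible S q a \<Longrightarrow> \<bar>system_cost S q a\<bar> \<le> C"
proof -
  let ?Q = "{q. state_bounds S q}"
  let ?f = "\<lambda>z. system_cost S (fst z) (balancing_action (fst z) (snd z))"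
  have "?Q = cbox (\<chi> i. r_min S i) (\<chi> i. r_max S i) \<times> {p_min S .. p_max S}"
    by (auto simp: state_bounds_def mem_box_cart)
  then have "compact ?Q" by (simp add: compact_Times compact_cbox)
  then have c: "compact (?Q \<times> decisions S)" by (intro compact_Times compact_decisions)
  have "continuous_on UNIV ?f"
    using continuous_on_compose2[OF continuous_on_system_cost,
        where f="\<lambda>z. (fst z, balancing_action (fst z) (snd z))" and s=UNIV]
    by (simp add: balancing_action_def continuous_intros)
  then have "continuous_on (?Q \<times> decisions S) ?f" by (rule continuous_on_subset) simp
  then have "bounded (?f ` (?Q \<times> decisions S))"
    by (intro compact_imp_bounded compact_continuous_image c)
  then obtain C where C: "C > 0" "\<And>x. x \<in> ?f ` (?Q \<times> decisions S) \<Longrightarrow> norm x \<le> C"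
    unfolding bounded_pos by blast
  have "\<bar>system_cost S q a\<bar> \<le> C" if Q: "state_bounds S q" and F: "slot_feasible S q a" for q a
  proof -
    obtain x where "x \<in> decisions S" "a = balancing_action q x"
      using F unfolding slot_feasible_iff by blast
    then have "system_cost S q a \<in> ?f ` (?Q \<times> decisions S)"
      using Q by (intro image_eqI[where x="(q, x)"]) auto
    then show ?thesis using C(2) by force
  qed
  with C(1) show ?thesis by (intro that[of C]) auto
qed

text \<open>Majorant of the term that P3 adds to the cost, over all feasible charging. It depends on
  the level only, so a bound on the level turns into an integrable bound on the optimal per-slot
  value.\<close>

definition penalty_bound :: "real ^ 'n \<Rightarrow> real" where
  "penalty_bound s = (\<Sum>i\<in>storage_phases S. \<bar>s $ i - \<beta> S V i\<bar> * u_max S i / V i)"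

lemma abs_P3_objective_le:
  assumes "slot_feasible S q a"
  shows "\<bar>P3_objective S V s q a\<bar> \<le> \<bar>system_cost S q a\<bar> + penalty_bound s"
proof -
  have "\<bar>\<Sum>i\<in>storage_phases S. (s $ i - \<beta> S V i) * charging a $ i / V i\<bar> \<le> penalty_bound s"
    unfolding penalty_bound_def
  proof (rule order_trans[OF sum_abs sum_mono])
    fix i assume i: "i \<in> storage_phases S"
    show "\<bar>(s $ i - \<beta> S V i) * charging a $ i / V i\<bar> \<le> \<bar>s $ i - \<beta> S V i\<bar> * u_max S i / V i"
      using V_pos[OF i] abs_charging_le[OF assms i]
      by (auto simp: abs_mult intro!: divide_right_mono mult_left_mono)
  qed
  then show ?thesis unfolding P3_objective_def by linarith
qed

section \<open>The optimal per-slot value and its measurability\<close>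

definition slot_value :: "real ^ 'n \<Rightarrow> 'n state \<Rightarrow> real" where
  "slot_value s q = (INF x\<in>decisions S. P3_objective S V s q (balancing_action q x))"

lemma continuous_on_decision_cost:
  "continuous_on UNIV (\<lambda>x. P3_objective S V s q (balancing_action q x))"
  using continuous_on_compose2[OF continuous_on_P3_objective, where f="\<lambda>x. (s, q, x)" and s=UNIV]
  by (simp add: continuous_intros)

lemma bdd_below_decision_cost:
  "bdd_below ((\<lambda>x. P3_objective S V s q (balancing_action q x)) ` decisions S)"
  by (intro bounded_imp_bdd_below compact_imp_bounded compact_continuous_image compact_decisions
      continuous_on_subset[OF continuous_on_decision_cost]) simp

lemma slot_value_le:
  assumes "slot_feasible S q a"
  shows "slot_value s q \<le> P3_objective S V s q a"
proof -
  obtain x where "x \<in> decisions S" "a = balancing_action q x"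
    using assms unfolding slot_feasible_iff by blast
  then show ?thesis
    unfolding slot_value_def by (auto intro: cINF_lower[OF bdd_below_decision_cost])
qed

lemma P3_solution_le_slot_value:
  assumes "P3_solution S V s q a"
  shows "P3_objective S V s q a \<le> slot_value s q"
  unfolding slot_value_def
proof (rule cINF_greatest[OF decisions_nonempty])
  fix x assume "x \<in> decisions S"
  then have "slot_feasible S q (balancing_action q x)" by (auto simp: slot_feasible_iff)
  then show "P3_objective S V s q a \<le> P3_objective S V s q (balancing_action q x)"
    using assms unfolding P3_solution_def is_arg_min_linorder by blast
qed

lemma abs_slot_value_le:
  assumes "\<And>a. slot_feasible S q a \<Longrightarrow> \<bar>system_cost S q a\<bar> \<le> C"
  shows "\<bar>slot_value s q\<bar> \<le> C + penalty_bound s"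
  unfolding slot_value_def
proof (rule cInf_abs_ge)
  show "(\<lambda>x. P3_objective S V s q (balancing_action q x)) ` decisions S \<noteq> {}"
    using decisions_nonempty by simp
  fix y assume "y \<in> (\<lambda>x. P3_objective S V s q (balancing_action q x)) ` decisions S"
  then obtain x where x: "x \<in> decisions S" "y = P3_objective S V s q (balancing_action q x)" by blast
  then have "slot_feasible S q (balancing_action q x)" by (auto simp: slot_feasible_iff)
  from abs_P3_objective_le[OF this, of s] assms[OF this] x(2) show "\<bar>y\<bar> \<le> C + penalty_bound s"
    by linarith
qed

text \<open>An uncountable infimum of measurable functions need not be measurable, but continuity in
  the decision gives a countable dense subset \<open>D\<close> the same infimum. Working with the
  value instead of a minimizer avoids any measurable selection.\<close>

lemma borel_measurable_slot_value:
  "(\<lambda>z. slot_value (fst z) (snd z)) \<in> borel_measurable borel"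
proof -
  let ?h = "\<lambda>z x. P3_objective S V (fst z) (snd z) (balancing_action (snd z) x)"
  obtain D where D: "countable D" "D \<subseteq> decisions S" "decisions S \<subseteq> closure D"
    using separable by blast
  have D_ne: "D \<noteq> {}" using D(3) decisions_nonempty by auto
  have bdd: "bdd_below (?h z ` D)" for z
    using bdd_below_mono[OF bdd_below_decision_cost image_mono[OF D(2)]] .
  have "slot_value (fst z) (snd z) = (INF x\<in>D. ?h z x)" for z
    unfolding slot_value_def
  proof (rule antisym)
    show "(INF x\<in>decisions S. ?h z x) \<le> (INF x\<in>D. ?h z x)"
      by (rule cINF_superset_mono[OF D_ne bdd_below_decision_cost D(2)]) simp
    \<comment> \<open>Closedness carries the bound from \<open>D\<close> to its closure, which
      contains every decision.\<close>
    have "closed {x. (INF x\<in>D. ?h z x) \<le> ?h z x}"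
      by (intro closed_Collect_le continuous_on_const continuous_on_decision_cost)
    moreover have "D \<subseteq> {x. (INF x\<in>D. ?h z x) \<le> ?h z x}"
      using cINF_lower[OF bdd] by blast
    ultimately have "decisions S \<subseteq> {x. (INF x\<in>D. ?h z x) \<le> ?h z x}"
      using closure_minimal D(3) by blast
    then show "(INF x\<in>D. ?h z x) \<le> (INF x\<in>decisions S. ?h z x)"
      by (intro cINF_greatest[OF decisions_nonempty]) blast
  qed
  moreover have "(\<lambda>z. INF x\<in>D. ?h z x) \<in> borel_measurable borel"
  proof (rule borel_measurable_cINF[OF D(1)])
    fix x assume "x \<in> D"
    show "(\<lambda>z. ?h z x) \<in> borel_measurable borel"
      using continuous_on_compose2[OF continuous_on_P3_objective,
          where f="\<lambda>z. (fst z, snd z, x)" and s=UNIV]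
      by (intro borel_measurable_continuous_onI) (simp add: continuous_intros)
  qed (rule bdd)
  ultimately show ?thesis by simp
qed

end

section \<open>Policies and expectations\<close>

locale storage_control = storage_system S V + prob_space M
  for S :: "('n::finite) network" and V :: "'n \<Rightarrow> real" and M :: "'w measure" +
  fixes s0 :: "'w \<Rightarrow> real ^ 'n"
    and q :: "nat \<Rightarrow> 'w \<Rightarrow> 'n state"
    and \<xi> :: "nat \<Rightarrow> 'w \<Rightarrow> real"
  assumes environment: "random_environment S M s0 q \<xi>"
begin

abbreviation storage_level :: "(nat \<Rightarrow> 'w \<Rightarrow> 'n action) \<Rightarrow> nat \<Rightarrow> 'w \<Rightarrow> real ^ 'n" where
  "storage_level b t \<omega> \<equiv> energy (s0 \<omega>) (\<lambda>k. b k \<omega>) t"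

section \<open>Laws of the environment and independence from the past\<close>

lemma indep_vars_q: "indep_vars (\<lambda>_. borel) q UNIV"
  and indep_vars_\<xi>: "indep_vars (\<lambda>_. borel) \<xi> UNIV"
  and distr_q: "distr M borel (q t) = distr M borel (q 0)"
  using environment by (auto simp: random_environment_def iid_def)

lemma measurable_q [measurable]: "q t \<in> borel_measurable M"
  and measurable_\<xi> [measurable]: "\<xi> t \<in> borel_measurable M"
  using indep_vars_q indep_vars_\<xi> by (auto simp: indep_vars_def)

lemma measurable_s0 [measurable]: "s0 \<in> borel_measurable M"
  using environment by (auto simp: random_environment_def indep_rv_def)

lemma AE_state_bounds: "AE \<omega> in M. \<forall>t. state_bounds S (q t \<omega>)"
  and AE_energy_bounds: "AE \<omega> in M. energy_bounds S (s0 \<omega>)"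
  using environment by (auto simp: random_environment_def)

lemma expectation_q_eq:
  fixes f :: "'n state \<Rightarrow> real"
  assumes "f \<in> borel_measurable borel"
  shows "expectation (\<lambda>\<omega>. f (q t \<omega>)) = expectation (\<lambda>\<omega>. f (q k \<omega>))"
proof -
  have "expectation (\<lambda>\<omega>. f (q t \<omega>)) = integral\<^sup>L (distr M borel (q t)) f" for t
    using assms by (subst integral_distr) auto
  then show ?thesis using distr_q by metis
qed

text \<open>The states stop before \<open>t\<close>, but all seeds may be included, present and
  future ones too, because the seed sequence is independent of initial levels and states jointly.
  Independence over time separates \<open>q t\<close> from the earlier states; \<open>s0\<close> and
  the seeds are then added by regrouping.\<close>

lemma indep_past_state:
  "indep_rv M (PiM UNIV (\<lambda>_. borel) \<Otimes>\<^sub>M (borel \<Otimes>\<^sub>M PiM {..<t} (\<lambda>_. borel)))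
     (\<lambda>\<omega>. (\<lambda>k. \<xi> k \<omega>, s0 \<omega>, \<lambda>k\<in>{..<t}. q k \<omega>)) borel (q t)"
proof -
  let ?P = "PiM UNIV (\<lambda>_. borel) :: (nat \<Rightarrow> 'n state) measure"
  let ?past = "\<lambda>\<omega>. \<lambda>k\<in>{..<t}. q k \<omega>"
  have seeds: "indep_rv M (PiM UNIV (\<lambda>_. borel)) (\<lambda>\<omega> k. \<xi> k \<omega>) (borel \<Otimes>\<^sub>M ?P) (\<lambda>\<omega>. (s0 \<omega>, \<lambda>k. q k \<omega>))"
    and init: "indep_rv M borel s0 ?P (\<lambda>\<omega> k. q k \<omega>)"
    using environment by (auto simp: random_environment_def)
  \<comment> \<open>The current state enters as a family indexed by \<open>{t}\<close>, so that both
    sides are functions on time; projection to coordinate \<open>t\<close> recovers it.\<close>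
  have "indep_var (PiM {..<t} (\<lambda>_. borel)) (\<lambda>\<omega>. restrict (\<lambda>k. q k \<omega>) {..<t})
      (PiM {t} (\<lambda>_. borel)) (\<lambda>\<omega>. restrict (\<lambda>k. q k \<omega>) {t})"
    by (rule indep_var_restrict[OF indep_vars_q]) auto
  then have "indep_rv M (PiM {..<t} (\<lambda>_. borel)) ?past (PiM {t} (\<lambda>_. borel)) (\<lambda>\<omega>. restrict (\<lambda>k. q k \<omega>) {t})"
    by (simp add: indep_rv_iff_distr indep_var_distribution_eq)
  from indep_rv_compose[OF this measurable_id measurable_component_singleton[of t "{t}"]]
  have past: "indep_rv M (PiM {..<t} (\<lambda>_. borel)) ?past borel (q t)"
    by simp
  have split[measurable]: "(\<lambda>y. (restrict y {..<t}, y t)) \<in> measurable ?P (PiM {..<t} (\<lambda>_. borel) \<Otimes>\<^sub>M borel)"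
    by (intro measurable_Pair measurable_restrict_subset measurable_component_singleton) auto
  have "indep_rv M borel s0 (PiM {..<t} (\<lambda>_. borel) \<Otimes>\<^sub>M borel) (\<lambda>\<omega>. (?past \<omega>, q t \<omega>))"
    using indep_rv_compose[OF init measurable_id split] by simp
  from indep_rv_assoc[OF this past]
  have s0_past: "indep_rv M (borel \<Otimes>\<^sub>M PiM {..<t} (\<lambda>_. borel)) (\<lambda>\<omega>. (s0 \<omega>, ?past \<omega>)) borel (q t)" .
  have "(\<lambda>z. ((fst z, restrict (snd z) {..<t}), snd z t))
      \<in> measurable (borel \<Otimes>\<^sub>M ?P) ((borel \<Otimes>\<^sub>M PiM {..<t} (\<lambda>_. borel)) \<Otimes>\<^sub>M borel)"
    by (intro measurable_Pair measurable_fst measurable_compose[OF measurable_snd]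
        measurable_restrict_subset measurable_component_singleton) auto
  from indep_rv_compose[OF seeds measurable_id this]
  have "indep_rv M (PiM UNIV (\<lambda>_. borel)) (\<lambda>\<omega> k. \<xi> k \<omega>)
      ((borel \<Otimes>\<^sub>M PiM {..<t} (\<lambda>_. borel)) \<Otimes>\<^sub>M borel) (\<lambda>\<omega>. ((s0 \<omega>, ?past \<omega>), q t \<omega>))"
    by simp
  from indep_rv_assoc[OF this s0_past] show ?thesis .
qed

text \<open>The level at \<open>t\<close> contains the charging of slots \<open>k < t\<close> only,
  and the action of slot \<open>k\<close> reads states up to \<open>k\<close>, so \<open>q t\<close>
  does not enter. Through \<open>\<sigma>\<close> the independence of the past passes to the
  level.\<close>

lemma storage_level_function_of_past:
  assumes "nonanticipative M s0 q \<xi> b"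
  obtains \<sigma> where
    "\<sigma> \<in> borel_measurable (PiM UNIV (\<lambda>_. borel) \<Otimes>\<^sub>M (borel \<Otimes>\<^sub>M PiM {..<t} (\<lambda>_. borel)))"
    "\<And>\<omega>. \<omega> \<in> space M \<Longrightarrow> storage_level b t \<omega> = \<sigma> (\<lambda>k. \<xi> k \<omega>, s0 \<omega>, \<lambda>k\<in>{..<t}. q k \<omega>)"
proof -
  let ?N = "PiM UNIV (\<lambda>_. borel) \<Otimes>\<^sub>M (borel \<Otimes>\<^sub>M PiM {..<t} (\<lambda>_. borel))
    :: ((nat \<Rightarrow> real) \<times> (real ^ 'n) \<times> (nat \<Rightarrow> 'n state)) measure"
  have "\<forall>k. \<exists>p. p \<in> borel_measurable (borel \<Otimes>\<^sub>M PiM {..k} (\<lambda>_. borel) \<Otimes>\<^sub>M PiM {..k} (\<lambda>_. borel))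
      \<and> (\<forall>\<omega>\<in>space M. b k \<omega> = p (history s0 q \<xi> k \<omega>))"
    using assms unfolding nonanticipative_def by blast
  from choice[OF this] obtain \<pi> where \<pi>: "\<And>k. \<pi> k \<in> borel_measurable
        (borel \<Otimes>\<^sub>M PiM {..k} (\<lambda>_. borel) \<Otimes>\<^sub>M PiM {..k} (\<lambda>_. borel))"
      "\<And>k \<omega>. \<omega> \<in> space M \<Longrightarrow> b k \<omega> = \<pi> k (history s0 q \<xi> k \<omega>)"
    by blast
  \<comment> \<open>\<open>\<pi> k\<close> expects a history indexed by \<open>{..k}\<close>. Since
    \<open>k < t\<close>, restricting the longer past yields exactly that, reordered as initial
    level, states, seeds.\<close>
  define \<sigma> where "\<sigma> z = fst (snd z) + (\<Sum>k<t. charging (\<pi> k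
      (fst (snd z), restrict (snd (snd z)) {..k}, restrict (fst z) {..k})))" for z
  show ?thesis
  proof (rule that)
    show "\<sigma> \<in> borel_measurable ?N"
      unfolding \<sigma>_def
    proof (intro borel_measurable_add borel_measurable_sum)
      fix k assume "k \<in> {..<t}"
      then have "(\<lambda>z. (fst (snd z), restrict (snd (snd z)) {..k}, restrict (fst z) {..k}))
          \<in> measurable ?N (borel \<Otimes>\<^sub>M PiM {..k} (\<lambda>_. borel) \<Otimes>\<^sub>M PiM {..k} (\<lambda>_. borel))"
        by (intro measurable_Pair measurable_compose[OF measurable_snd measurable_fst]
            measurable_compose[OF measurable_compose[OF measurable_snd measurable_snd]]
            measurable_compose[OF measurable_fst] measurable_restrict_subset) auto
      from measurable_compose[OF this \<pi>(1)]
      have "(\<lambda>z. \<pi> k (fst (snd z), restrict (snd (snd z)) {..k}, restrict (fst z) {..k}))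
          \<in> borel_measurable ?N" .
      then show "(\<lambda>z. charging (\<pi> k (fst (snd z), restrict (snd (snd z)) {..k}, restrict (fst z) {..k})))
          \<in> borel_measurable ?N"
        by (rule measurable_compose) (intro borel_measurable_continuous_onI continuous_intros)
    qed measurable
    fix \<omega> assume \<omega>: "\<omega> \<in> space M"
    have "history s0 q \<xi> k \<omega>
        = (s0 \<omega>, restrict (\<lambda>k\<in>{..<t}. q k \<omega>) {..k}, restrict (\<lambda>k. \<xi> k \<omega>) {..k})" if "k < t" for k
      using that by (auto simp: history_def restrict_def fun_eq_iff)
    then show "storage_level b t \<omega> = \<sigma> (\<lambda>k. \<xi> k \<omega>, s0 \<omega>, \<lambda>k\<in>{..<t}. q k \<omega>)"
      by (simp add: energy_eq_sum \<sigma>_def \<pi>(2)[OF \<omega>])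
  qed
qed

section \<open>Measurability and integrability along a policy\<close>

lemma nonanticipative_measurable:
  assumes "nonanticipative M s0 q \<xi> b"
  shows "b t \<in> borel_measurable M"
proof -
  obtain \<pi> where \<pi>: "\<pi> \<in> borel_measurable
        (borel \<Otimes>\<^sub>M PiM {..t} (\<lambda>_. borel) \<Otimes>\<^sub>M PiM {..t} (\<lambda>_. borel))"
      "\<And>\<omega>. \<omega> \<in> space M \<Longrightarrow> b t \<omega> = \<pi> (history s0 q \<xi> t \<omega>)"
    using assms unfolding nonanticipative_def by blast
  have "history s0 q \<xi> t \<in> measurable M
      (borel \<Otimes>\<^sub>M PiM {..t} (\<lambda>_. borel) \<Otimes>\<^sub>M PiM {..t} (\<lambda>_. borel))"
    unfolding history_def by measurable
  from measurable_compose[OF this \<pi>(1)] show ?thesis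
    by (subst measurable_cong[OF \<pi>(2)])
qed

lemma integrable_AE_bounded:
  fixes f :: "'w \<Rightarrow> real"
  assumes "f \<in> borel_measurable M" "AE \<omega> in M. \<bar>f \<omega>\<bar> \<le> B"
  shows "integrable M f"
  using assms by (intro integrable_const_bound[of _ B]) auto

text \<open>The common part of feasibility for P1 and of Algorithm 1: the per-slot constraints
  without the energy bounds. Measurability and integrability are derived from it once for
  both.\<close>

definition slotwise_feasible :: "(nat \<Rightarrow> 'w \<Rightarrow> 'n action) \<Rightarrow> bool" where
  "slotwise_feasible b \<longleftrightarrow>
     nonanticipative M s0 q \<xi> b \<and> (AE \<omega> in M. \<forall>t. slot_feasible S (q t \<omega>) (b t \<omega>))"

context
  fixes b assumes b: "slotwise_feasible b"
begin

lemma measurable_action [measurable]: "b t \<in> borel_measurable M"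
  using b nonanticipative_measurable by (auto simp: slotwise_feasible_def)

lemma measurable_charging [measurable]: "(\<lambda>\<omega>. charging (b t \<omega>)) \<in> borel_measurable M"
  by (rule measurable_compose[OF measurable_action])
     (intro borel_measurable_continuous_onI continuous_intros)

lemma measurable_charging_nth [measurable]: "(\<lambda>\<omega>. charging (b t \<omega>) $ i) \<in> borel_measurable M"
  by (rule measurable_compose[OF measurable_action])
     (intro borel_measurable_continuous_onI continuous_intros)

lemma measurable_storage_level [measurable]: "storage_level b t \<in> borel_measurable M"
  unfolding energy_eq_sum by measurable

lemma measurable_storage_level_nth [measurable]:
  "(\<lambda>\<omega>. storage_level b t \<omega> $ i) \<in> borel_measurable M"
  by (rule measurable_compose[OF measurable_storage_level])
     (intro borel_measurable_continuous_onI continuous_intros)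

lemma AE_slot_feasible: "AE \<omega> in M. \<forall>t. slot_feasible S (q t \<omega>) (b t \<omega>)"
  using b by (simp add: slotwise_feasible_def)

lemma measurable_system_cost [measurable]:
  "(\<lambda>\<omega>. system_cost S (q t \<omega>) (b t \<omega>)) \<in> borel_measurable M"
proof -
  have "(\<lambda>\<omega>. (q t \<omega>, b t \<omega>)) \<in> borel_measurable M" by measurable
  from measurable_compose[OF this borel_measurable_continuous_onI[OF continuous_on_system_cost]]
  show ?thesis by simp
qed

lemma system_cost_AE_bounded:
  obtains C where "C \<ge> 0" "AE \<omega> in M. \<forall>t. \<bar>system_cost S (q t \<omega>) (b t \<omega>)\<bar> \<le> C"
proof -
  obtain C where C: "C \<ge> 0"
    "\<And>q a. state_bounds S q \<Longrightarrow> slot_feasible S q a \<Longrightarrow> \<bar>system_cost S q a\<bar> \<le> C"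
    using system_cost_bounded by blast
  have "AE \<omega> in M. \<forall>t. \<bar>system_cost S (q t \<omega>) (b t \<omega>)\<bar> \<le> C"
    using AE_state_bounds AE_slot_feasible by eventually_elim (use C in blast)
  with C(1) show ?thesis by (rule that)
qed

lemma integrable_system_cost: "integrable M (\<lambda>\<omega>. system_cost S (q t \<omega>) (b t \<omega>))"
proof -
  obtain C where "C \<ge> 0" "AE \<omega> in M. \<forall>t. \<bar>system_cost S (q t \<omega>) (b t \<omega>)\<bar> \<le> C"
    by (rule system_cost_AE_bounded)
  then show ?thesis
    by (intro integrable_AE_bounded[where B=C]) auto
qed

lemma average_cost_bounded:
  obtains C where "\<And>T. \<bar>average_cost S M q b T\<bar> \<le> C"
proof -
  obtain C where C: "C \<ge> 0" "AE \<omega> in M. \<forall>t. \<bar>system_cost S (q t \<omega>) (b t \<omega>)\<bar> \<le> C"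
    by (rule system_cost_AE_bounded)
  let ?w = "\<lambda>t. expectation (\<lambda>\<omega>. system_cost S (q t \<omega>) (b t \<omega>))"
  have w: "\<bar>?w t\<bar> \<le> C" for t
  proof -
    have "\<bar>?w t\<bar> \<le> expectation (\<lambda>\<omega>. \<bar>system_cost S (q t \<omega>) (b t \<omega>)\<bar>)"
      by (rule integral_abs_bound)
    also have "\<dots> \<le> C"
      using C(2) by (intro integral_le_const integrable_abs integrable_system_cost) auto
    finally show ?thesis .
  qed
  have "\<bar>average_cost S M q b T\<bar> \<le> C" for T
  proof (cases "T = 0")
    case False
    have "\<bar>\<Sum>t<T. ?w t\<bar> \<le> (\<Sum>t<T. C)"
      by (rule order_trans[OF sum_abs sum_mono]) (rule w)
    then show ?thesis
      using False by (simp add: average_cost_def abs_mult field_simps)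
  \<comment> \<open>For \<open>T = 0\<close> the average is an empty sum, hence 0, and the bound is
    \<open>C \<ge> 0\<close>.\<close>
  qed (simp add: average_cost_def C(1))
  then show ?thesis by (rule that)
qed

lemma integrable_charging:
  assumes "i \<in> storage_phases S"
  shows "integrable M (\<lambda>\<omega>. charging (b t \<omega>) $ i)"
proof (rule integrable_AE_bounded)
  show "AE \<omega> in M. \<bar>charging (b t \<omega>) $ i\<bar> \<le> u_max S i"
    using AE_slot_feasible by eventually_elim (use assms abs_charging_le in blast)
qed measurable

text \<open>Without energy bounds the level can drift by \<open>u_max S i\<close> in each slot. The
  resulting growth in \<open>t\<close> is harmless, since integrability is only required slot by
  slot.\<close>

lemma AE_abs_storage_level_le:
  assumes i: "i \<in> storage_phases S"
  shows "AE \<omega> in M. \<bar>storage_level b t \<omega> $ i\<bar> \<le> \<bar>s_min S i\<bar> + \<bar>s_max S i\<bar> + real t * u_max S i"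
  using AE_energy_bounds AE_slot_feasible
proof eventually_elim
  case (elim \<omega>)
  have s: "\<bar>s0 \<omega> $ i\<bar> \<le> \<bar>s_min S i\<bar> + \<bar>s_max S i\<bar>"
    using elim(1) i unfolding energy_bounds_def by force
  have "\<bar>\<Sum>k<t. charging (b k \<omega>) $ i\<bar> \<le> (\<Sum>k<t. u_max S i)"
    using elim(2) i abs_charging_le by (intro order_trans[OF sum_abs sum_mono]) blast
  with s show ?case by (simp add: energy_eq_sum)
qed

lemma integrable_drift_term:
  assumes i: "i \<in> storage_phases S"
  shows "integrable M (\<lambda>\<omega>. (storage_level b t \<omega> $ i - c) * charging (b t \<omega>) $ i)"
proof (rule integrable_AE_bounded)
  let ?B = "\<bar>s_min S i\<bar> + \<bar>s_max S i\<bar> + real t * u_max S i"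
  show "AE \<omega> in M. \<bar>(storage_level b t \<omega> $ i - c) * charging (b t \<omega>) $ i\<bar>
      \<le> (?B + \<bar>c\<bar>) * u_max S i"
    using AE_abs_storage_level_le[OF i, of t] AE_slot_feasible
  proof eventually_elim
    case (elim \<omega>)
    have "\<bar>charging (b t \<omega>) $ i\<bar> \<le> u_max S i" using elim(2) i abs_charging_le by blast
    with elim(1) show ?case unfolding abs_mult by (intro mult_mono) auto
  qed
qed measurable

lemma integrable_lyapunov:
  assumes i: "i \<in> storage_phases S"
  shows "integrable M (\<lambda>\<omega>. lyapunov S V i (storage_level b t \<omega> $ i))"
proof (rule integrable_AE_bounded)
  let ?B = "\<bar>s_min S i\<bar> + \<bar>s_max S i\<bar> + real t * u_max S i"
  show "AE \<omega> in M. \<bar>lyapunov S V i (storage_level b t \<omega> $ i)\<bar> \<le> (1/2) * (?B + \<bar>\<beta> S V i\<bar>)\<^sup>2"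
    using AE_abs_storage_level_le[OF i, of t]
  proof eventually_elim
    case (elim \<omega>)
    then have "\<bar>storage_level b t \<omega> $ i - \<beta> S V i\<bar> \<le> ?B + \<bar>\<beta> S V i\<bar>" by linarith
    then have "(storage_level b t \<omega> $ i - \<beta> S V i)\<^sup>2 \<le> (?B + \<bar>\<beta> S V i\<bar>)\<^sup>2"
      by (metis abs_ge_zero power2_abs power_mono)
    then show ?case by (simp add: lyapunov_def)
  qed
  show "(\<lambda>\<omega>. lyapunov S V i (storage_level b t \<omega> $ i)) \<in> borel_measurable M"
    unfolding lyapunov_def by measurable
qed

end

end

section \<open>Performance bound\<close>

context storage_control
begin

text \<open>The function \<open>G\<close> of the overview; slot 0 stands for any slot because the
  states share one law.\<close>

abbreviation expected_slot_value :: "real ^ 'n \<Rightarrow> real" where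
  "expected_slot_value s \<equiv> expectation (\<lambda>\<omega>. slot_value s (q 0 \<omega>))"

lemma measurable_slot_value_at: "slot_value s \<in> borel_measurable borel"
proof -
  have "(\<lambda>x::'n state. (s, x)) \<in> borel_measurable borel"
    by (intro borel_measurable_continuous_onI continuous_intros)
  from measurable_compose[OF this borel_measurable_slot_value] show ?thesis by simp
qed

lemma measurable_slot_value [measurable]:
  assumes [measurable]: "X \<in> borel_measurable M"
  shows "(\<lambda>\<omega>. slot_value (X \<omega>) (q t \<omega>)) \<in> borel_measurable M"
proof -
  have "(\<lambda>\<omega>. (X \<omega>, q t \<omega>)) \<in> borel_measurable M" by measurable
  from measurable_compose[OF this borel_measurable_slot_value] show ?thesis by simp
qed

lemma integrable_slot_value:
  assumes X: "X \<in> borel_measurable M" and B: "AE \<omega> in M. penalty_bound (X \<omega>) \<le> B"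
  shows "integrable M (\<lambda>\<omega>. slot_value (X \<omega>) (q t \<omega>))"
proof -
  obtain C where "C \<ge> 0" and C:
    "\<And>q a. state_bounds S q \<Longrightarrow> slot_feasible S q a \<Longrightarrow> \<bar>system_cost S q a\<bar> \<le> C"
    using system_cost_bounded by blast
  show ?thesis
  proof (rule integrable_AE_bounded)
    show "AE \<omega> in M. \<bar>slot_value (X \<omega>) (q t \<omega>)\<bar> \<le> C + B"
      using B AE_state_bounds
    proof eventually_elim
      case (elim \<omega>)
      have "\<bar>slot_value (X \<omega>) (q t \<omega>)\<bar> \<le> C + penalty_bound (X \<omega>)"
        using elim(2) by (intro abs_slot_value_le C) auto
      with elim(1) show ?case by linarith
    qed
  qed (use X in measurable)
qed

lemma P1_feasible_slotwise: "P1_feasible S M s0 q \<xi> b \<Longrightarrow> slotwise_feasible b"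
  by (auto simp: P1_feasible_def slotwise_feasible_def elim: eventually_mono)

lemma algorithm1_slotwise: "algorithm1 S V M s0 q \<xi> b \<Longrightarrow> slotwise_feasible b"
  by (auto simp: algorithm1_def slotwise_feasible_def P3_solution_def is_arg_min_def
      elim: eventually_mono)

section \<open>Lower bound on the optimum of P1\<close>

lemma P3_objective_weighted:
  "P3_objective S V s x y = system_cost S x y
     + (\<Sum>i\<in>storage_phases S. ((s $ i - \<beta> S V i) / V i) * charging y $ i)"
  by (simp add: P3_objective_def)

text \<open>With \<open>s\<close> a fixed vector, minimality holds outcome by outcome for every
  slot-feasible action, however it was chosen. The energy bounds enter through the telescoping
  alone.\<close>

lemma expected_slot_value_le_P1_objective:
  assumes feas: "P1_feasible S M s0 q \<xi> b"
  shows "ereal (expected_slot_value s) \<le> P1_objective S M q b"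
proof -
  note b = P1_feasible_slotwise[OF feas]
  note [measurable] = measurable_action[OF b] measurable_charging_nth[OF b]
    measurable_storage_level[OF b] measurable_system_cost[OF b]
  note int_w = integrable_system_cost[OF b] and int_u = integrable_charging[OF b]
  define c where "c i = (s $ i - \<beta> S V i) / V i" for i
  define R where "R = (\<Sum>i\<in>storage_phases S. \<bar>c i\<bar> * (s_max S i - s_min S i))"
  let ?G = "expected_slot_value s"
  let ?w = "\<lambda>t. expectation (\<lambda>\<omega>. system_cost S (q t \<omega>) (b t \<omega>))"
  let ?u = "\<lambda>t i. expectation (\<lambda>\<omega>. charging (b t \<omega>) $ i)"
  have int_p: "integrable M (\<lambda>\<omega>. P3_objective S V s (q t \<omega>) (b t \<omega>))" for t
    unfolding P3_objective_weighted by (intro Bochner_Integration.integrable_add int_w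
        Bochner_Integration.integrable_sum integrable_mult_right int_u)
  have slot: "?G \<le> ?w t + (\<Sum>i\<in>storage_phases S. c i * ?u t i)" for t
  proof -
    have "?G = expectation (\<lambda>\<omega>. slot_value s (q t \<omega>))"
      by (rule expectation_q_eq[OF measurable_slot_value_at])
    also have "\<dots> \<le> expectation (\<lambda>\<omega>. P3_objective S V s (q t \<omega>) (b t \<omega>))"
    proof (rule integral_mono_AE[OF _ int_p])
      show "integrable M (\<lambda>\<omega>. slot_value s (q t \<omega>))"
        by (rule integrable_slot_value[where B="penalty_bound s"]) auto
      show "AE \<omega> in M. slot_value s (q t \<omega>) \<le> P3_objective S V s (q t \<omega>) (b t \<omega>)"
        using AE_slot_feasible[OF b] by eventually_elim (use slot_value_le in blast)
    qed
    also have "\<dots> = ?w t + (\<Sum>i\<in>storage_phases S. c i * ?u t i)"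
    proof -
      have int_c: "integrable M (\<lambda>\<omega>. c i * charging (b t \<omega>) $ i)" if "i \<in> storage_phases S" for i
        using int_u[OF that] by (rule integrable_mult_right)
      have "expectation (\<lambda>\<omega>. system_cost S (q t \<omega>) (b t \<omega>)
            + (\<Sum>i\<in>storage_phases S. c i * charging (b t \<omega>) $ i))
        = ?w t + expectation (\<lambda>\<omega>. \<Sum>i\<in>storage_phases S. c i * charging (b t \<omega>) $ i)"
        by (intro Bochner_Integration.integral_add int_w Bochner_Integration.integrable_sum int_c)
      also have "expectation (\<lambda>\<omega>. \<Sum>i\<in>storage_phases S. c i * charging (b t \<omega>) $ i)
          = (\<Sum>i\<in>storage_phases S. c i * ?u t i)"
        by (simp add: Bochner_Integration.integral_sum[OF int_c] int_u)
      finally show ?thesis unfolding P3_objective_weighted c_def .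
    qed
    finally show ?thesis .
  qed
  have total: "\<bar>\<Sum>t<T. ?u t i\<bar> \<le> s_max S i - s_min S i" if i: "i \<in> storage_phases S" for T i
  proof -
    have int_sum: "integrable M (\<lambda>\<omega>. \<Sum>t<T. charging (b t \<omega>) $ i)"
      by (intro Bochner_Integration.integrable_sum int_u i)
    have "(\<Sum>t<T. ?u t i) = expectation (\<lambda>\<omega>. \<Sum>t<T. charging (b t \<omega>) $ i)"
      by (subst Bochner_Integration.integral_sum) (auto intro: int_u i)
    then have "\<bar>\<Sum>t<T. ?u t i\<bar> \<le> expectation (\<lambda>\<omega>. \<bar>\<Sum>t<T. charging (b t \<omega>) $ i\<bar>)"
      using integral_abs_bound by metis
    also have "\<dots> \<le> s_max S i - s_min S i"
    proof (rule integral_le_const[OF integrable_abs[OF int_sum]])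
      have "AE \<omega> in M. \<forall>t. energy_bounds S (storage_level b t \<omega>)"
        using feas by (auto simp: P1_feasible_def elim: eventually_mono)
      with AE_energy_bounds
      show "AE \<omega> in M. \<bar>\<Sum>t<T. charging (b t \<omega>) $ i\<bar> \<le> s_max S i - s_min S i"
      proof eventually_elim
        case (elim \<omega>)
        have "(\<Sum>t<T. charging (b t \<omega>) $ i) = storage_level b T \<omega> $ i - s0 \<omega> $ i"
          by (simp add: energy_eq_sum)
        moreover have "s_min S i \<le> s0 \<omega> $ i" "s0 \<omega> $ i \<le> s_max S i"
          "s_min S i \<le> storage_level b T \<omega> $ i" "storage_level b T \<omega> $ i \<le> s_max S i"
          using elim i by (auto simp: energy_bounds_def)
        ultimately show ?case by linarith
      qed
    qed
    finally show ?thesis .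
  qed
  have avg: "?G - R / real T \<le> average_cost S M q b T" if T: "T \<ge> 1" for T :: nat
  proof -
    have "real T * ?G = (\<Sum>t<T. ?G)" by simp
    also have "\<dots> \<le> (\<Sum>t<T. ?w t + (\<Sum>i\<in>storage_phases S. c i * ?u t i))"
      by (intro sum_mono slot)
    also have "\<dots> = (\<Sum>t<T. ?w t) + (\<Sum>i\<in>storage_phases S. c i * (\<Sum>t<T. ?u t i))"
      unfolding sum.distrib sum_distrib_left by (subst (2) sum.swap) (rule refl)
    also have "(\<Sum>i\<in>storage_phases S. c i * (\<Sum>t<T. ?u t i)) \<le> R"
      unfolding R_def
    proof (rule sum_mono)
      fix i assume i: "i \<in> storage_phases S"
      have "c i * (\<Sum>t<T. ?u t i) \<le> \<bar>c i\<bar> * \<bar>\<Sum>t<T. ?u t i\<bar>"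
        unfolding abs_mult[symmetric] by (rule abs_ge_self)
      also have "\<dots> \<le> \<bar>c i\<bar> * (s_max S i - s_min S i)"
        by (intro mult_left_mono total i) simp
      finally show "c i * (\<Sum>t<T. ?u t i) \<le> \<bar>c i\<bar> * (s_max S i - s_min S i)" .
    qed
    finally have "real T * ?G \<le> (\<Sum>t<T. ?w t) + R" by simp
    then have "?G \<le> ((\<Sum>t<T. ?w t) + R) / real T"
      using T by (simp add: pos_le_divide_eq mult.commute)
    then show ?thesis by (simp add: average_cost_def add_divide_distrib)
  qed
  have "(\<lambda>T. ereal (?G - R / real T)) \<longlonglongrightarrow> ereal (?G - 0)"
    by (intro tendsto_ereal tendsto_diff tendsto_const lim_const_over_n)
  from lim_imp_Limsup[OF sequentially_bot this]
  have "ereal ?G = limsup (\<lambda>T. ereal (?G - R / real T))" by simp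
  also have "\<dots> \<le> P1_objective S M q b"
    unfolding P1_objective_def
    by (intro Limsup_mono eventually_sequentiallyI[of 1]) (simp add: avg)
  finally show ?thesis .
qed

section \<open>Upper bound on the cost of Algorithm 1\<close>

lemma algorithm1_expected_P3_objective_le:
  assumes alg: "algorithm1 S V M s0 q \<xi> a" and J: "\<And>s. expected_slot_value s \<le> J"
  shows "expectation (\<lambda>\<omega>. P3_objective S V (storage_level a t \<omega>) (q t \<omega>) (a t \<omega>)) \<le> J"
proof -
  note a = algorithm1_slotwise[OF alg]
  note [measurable] = measurable_storage_level[OF a]
  \<comment> \<open>A crude bound that grows with \<open>t\<close>; it only has to make the value in
    this one slot integrable.\<close>
  let ?B = "\<Sum>i\<in>storage_phases S. (\<bar>s_min S i\<bar> + \<bar>s_max S i\<bar> + real t * u_max S i + \<bar>\<beta> S V i\<bar>)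
    * u_max S i / V i"
  have "AE \<omega> in M. \<forall>i\<in>storage_phases S.
      \<bar>storage_level a t \<omega> $ i\<bar> \<le> \<bar>s_min S i\<bar> + \<bar>s_max S i\<bar> + real t * u_max S i"
    by (intro AE_finite_allI AE_abs_storage_level_le[OF a]) auto
  then have "AE \<omega> in M. penalty_bound (storage_level a t \<omega>) \<le> ?B"
  proof eventually_elim
    case (elim \<omega>)
    show ?case
      unfolding penalty_bound_def
    proof (rule sum_mono)
      fix i assume i: "i \<in> storage_phases S"
      have "\<bar>storage_level a t \<omega> $ i - \<beta> S V i\<bar>
          \<le> \<bar>s_min S i\<bar> + \<bar>s_max S i\<bar> + real t * u_max S i + \<bar>\<beta> S V i\<bar>"
        using elim i by force
      then show "\<bar>storage_level a t \<omega> $ i - \<beta> S V i\<bar> * u_max S i / V i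
          \<le> (\<bar>s_min S i\<bar> + \<bar>s_max S i\<bar> + real t * u_max S i + \<bar>\<beta> S V i\<bar>) * u_max S i / V i"
        using V_pos[OF i] u_max_nonneg[OF i] by (intro divide_right_mono mult_right_mono) auto
    qed
  qed
  then have int_v: "integrable M (\<lambda>\<omega>. slot_value (storage_level a t \<omega>) (q t \<omega>))"
    by (intro integrable_slot_value) measurable
  have int_d: "integrable M (\<lambda>\<omega>. (storage_level a t \<omega> $ i - \<beta> S V i) * charging (a t \<omega>) $ i / V i)"
    if "i \<in> storage_phases S" for i
    using integrable_drift_term[OF a that] by (rule integrable_divide_zero)
  have int_p: "integrable M (\<lambda>\<omega>. P3_objective S V (storage_level a t \<omega>) (q t \<omega>) (a t \<omega>))"
    unfolding P3_objective_def
    by (intro Bochner_Integration.integrable_add integrable_system_cost[OF a]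
        Bochner_Integration.integrable_sum int_d)
  have "expectation (\<lambda>\<omega>. P3_objective S V (storage_level a t \<omega>) (q t \<omega>) (a t \<omega>))
      \<le> expectation (\<lambda>\<omega>. slot_value (storage_level a t \<omega>) (q t \<omega>))"
  proof (rule integral_mono_AE[OF int_p int_v])
    have "AE \<omega> in M. \<forall>t. P3_solution S V (storage_level a t \<omega>) (q t \<omega>) (a t \<omega>)"
      using alg by (simp add: algorithm1_def)
    then show "AE \<omega> in M. P3_objective S V (storage_level a t \<omega>) (q t \<omega>) (a t \<omega>)
        \<le> slot_value (storage_level a t \<omega>) (q t \<omega>)"
      by eventually_elim (use P3_solution_le_slot_value in blast)
  qed
  also have "\<dots> \<le> J"
  proof -
    let ?N = "PiM UNIV (\<lambda>_. borel) \<Otimes>\<^sub>M (borel \<Otimes>\<^sub>M PiM {..<t} (\<lambda>_. borel))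
      :: ((nat \<Rightarrow> real) \<times> (real ^ 'n) \<times> (nat \<Rightarrow> 'n state)) measure"
    let ?past = "\<lambda>\<omega>. (\<lambda>k. \<xi> k \<omega>, s0 \<omega>, \<lambda>k\<in>{..<t}. q k \<omega>)"
    have "nonanticipative M s0 q \<xi> a" using alg by (simp add: algorithm1_def)
    then obtain \<sigma> where \<sigma>[measurable]: "\<sigma> \<in> borel_measurable ?N"
      and past: "\<And>\<omega>. \<omega> \<in> space M \<Longrightarrow> storage_level a t \<omega> = \<sigma> (?past \<omega>)"
      by (rule storage_level_function_of_past[where t=t]) blast
    let ?\<phi> = "\<lambda>z. slot_value (\<sigma> (fst z)) (snd z)"
    have "(\<lambda>z. (\<sigma> (fst z), snd z)) \<in> borel_measurable (?N \<Otimes>\<^sub>M (borel :: 'n state measure))"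
      by (intro borel_measurable_Pair measurable_compose[OF measurable_fst \<sigma>] measurable_snd)
    from measurable_compose[OF this borel_measurable_slot_value]
    have \<phi>: "?\<phi> \<in> borel_measurable (?N \<Otimes>\<^sub>M borel)" by simp
    have "expectation (\<lambda>\<omega>. ?\<phi> (?past \<omega>, q t \<omega>)) \<le> J"
    proof (rule expectation_le_of_indep_rv[OF indep_past_state \<phi>])
      show "integrable M (\<lambda>\<omega>. ?\<phi> (?past \<omega>, q t \<omega>))"
        using int_v by (simp add: past cong: Bochner_Integration.integrable_cong)
      \<comment> \<open>With the past frozen at \<open>x\<close> the level is the constant
        \<open>\<sigma> x\<close>, and replacing slot \<open>t\<close> by slot 0 turns the
        expectation into \<open>G (\<sigma> x)\<close>, which \<open>J\<close> bounds for every
        level.\<close>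
      show "expectation (\<lambda>\<omega>. ?\<phi> (x, q t \<omega>)) \<le> J" for x
        using J[of "\<sigma> x"] expectation_q_eq[OF measurable_slot_value_at, of "\<sigma> x" t 0] by simp
    qed
    then show ?thesis by (simp add: past cong: Bochner_Integration.integral_cong)
  qed
  finally show ?thesis .
qed

text \<open>Expansion of \<open>(s + u - \<beta>)\<^sup>2\<close>. The left side is the cross term,
  which P3 adds to the cost after division by \<open>V i\<close>; this is why P3 controls the
  drift.\<close>

lemma drift_identity:
  "(s - \<beta> S V i) * u = lyapunov S V i (s + u) - lyapunov S V i s - u\<^sup>2 / 2"
  by (simp add: lyapunov_def power2_eq_square field_simps)

text \<open>Each phase has its own \<open>V i\<close>, so its drift is divided by it separately.
  Bounding the squared charging by \<open>(u_max S i)\<^sup>2\<close> produces the constant, and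
  what remains are differences of \<open>L\<close> ready to telescope.\<close>

lemma algorithm1_expected_system_cost_le:
  assumes alg: "algorithm1 S V M s0 q \<xi> a" and J: "\<And>s. expected_slot_value s \<le> J"
  defines "L \<equiv> \<lambda>i t. expectation (\<lambda>\<omega>. lyapunov S V i (storage_level a t \<omega> $ i))"
  shows "expectation (\<lambda>\<omega>. system_cost S (q t \<omega>) (a t \<omega>))
      \<le> J + (\<Sum>i\<in>storage_phases S. (u_max S i)\<^sup>2 / (2 * V i) - (L i (Suc t) - L i t) / V i)"
proof -
  note a = algorithm1_slotwise[OF alg]
  note int_L = integrable_lyapunov[OF a] and int_d = integrable_drift_term[OF a]
  let ?d = "\<lambda>i \<omega>. (storage_level a t \<omega> $ i - \<beta> S V i) * charging (a t \<omega>) $ i"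
  have int_dV: "integrable M (\<lambda>\<omega>. ?d i \<omega> / V i)" if "i \<in> storage_phases S" for i
    using int_d[OF that] by (rule integrable_divide_zero)
  have drift: "L i (Suc t) - L i t - (u_max S i)\<^sup>2 / 2 \<le> expectation (?d i)"
    if i: "i \<in> storage_phases S" for i
  proof -
    let ?l = "\<lambda>t \<omega>. lyapunov S V i (storage_level a t \<omega> $ i)"
    have "L i (Suc t) - L i t - (u_max S i)\<^sup>2 / 2
        = expectation (\<lambda>\<omega>. ?l (Suc t) \<omega> - ?l t \<omega> - (u_max S i)\<^sup>2 / 2)"
      unfolding L_def using int_L[OF i, of "Suc t"] int_L[OF i, of t]
      \<comment> \<open>The recursion stays folded so that the level at \<open>Suc t\<close> keeps
        the shape of the integrability fact.\<close>
      by (simp del: energy.simps add: prob_space)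
    also have "\<dots> \<le> expectation (?d i)"
    proof (rule integral_mono_AE)
      show "AE \<omega> in M. ?l (Suc t) \<omega> - ?l t \<omega> - (u_max S i)\<^sup>2 / 2 \<le> ?d i \<omega>"
        using AE_slot_feasible[OF a]
      proof eventually_elim
        case (elim \<omega>)
        then have "\<bar>charging (a t \<omega>) $ i\<bar> \<le> u_max S i" using i abs_charging_le by blast
        then have "(charging (a t \<omega>) $ i)\<^sup>2 \<le> (u_max S i)\<^sup>2"
          by (metis abs_ge_zero power2_abs power_mono)
        then show ?case unfolding drift_identity by simp
      qed
    qed (intro Bochner_Integration.integrable_diff int_L int_d i integrable_const)+
    finally show ?thesis .
  qed
  have "expectation (\<lambda>\<omega>. P3_objective S V (storage_level a t \<omega>) (q t \<omega>) (a t \<omega>))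
      = expectation (\<lambda>\<omega>. system_cost S (q t \<omega>) (a t \<omega>))
        + expectation (\<lambda>\<omega>. \<Sum>i\<in>storage_phases S. ?d i \<omega> / V i)"
    unfolding P3_objective_def
    by (intro Bochner_Integration.integral_add integrable_system_cost[OF a]
        Bochner_Integration.integrable_sum int_dV)
  also have "expectation (\<lambda>\<omega>. \<Sum>i\<in>storage_phases S. ?d i \<omega> / V i)
      = (\<Sum>i\<in>storage_phases S. expectation (?d i) / V i)"
    by (subst Bochner_Integration.integral_sum) (auto intro: int_dV)
  finally have "expectation (\<lambda>\<omega>. system_cost S (q t \<omega>) (a t \<omega>))
      \<le> J - (\<Sum>i\<in>storage_phases S. expectation (?d i) / V i)"
    using algorithm1_expected_P3_objective_le[OF alg J, of t] by linarith
  also have "\<dots> \<le> J - (\<Sum>i\<in>storage_phases S. (L i (Suc t) - L i t - (u_max S i)\<^sup>2 / 2) / V i)"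
    by (intro diff_left_mono sum_mono divide_right_mono drift)
       (auto dest: V_pos)
  also have "\<dots> = J + (\<Sum>i\<in>storage_phases S. (u_max S i)\<^sup>2 / (2 * V i) - (L i (Suc t) - L i t) / V i)"
    unfolding sum_negf[symmetric] diff_conv_add_uminus[of J]
    by (intro arg_cong2[where f="(+)"] sum.cong refl) (simp add: diff_divide_distrib)
  finally show ?thesis .
qed

lemma algorithm1_average_cost_le:
  assumes alg: "algorithm1 S V M s0 q \<xi> a" and J: "\<And>s. expected_slot_value s \<le> J"
    and T: "T \<ge> 1"
  shows "average_cost S M q a T
      \<le> J + (\<Sum>i\<in>storage_phases S. (u_max S i)\<^sup>2 / (2 * V i)
            + expectation (\<lambda>\<omega>. lyapunov S V i (s0 \<omega> $ i)) / (real T * V i))"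
proof -
  define L where "L i t = expectation (\<lambda>\<omega>. lyapunov S V i (storage_level a t \<omega> $ i))" for i t
  let ?B = "\<lambda>i. (u_max S i)\<^sup>2 / (2 * V i)"
  \<comment> \<open>After telescoping, the terminal Lyapunov term carries a negative sign.
    Nonnegativity lets it be dropped, and only the initial term divided by \<open>T\<close>
    survives.\<close>
  have L_nonneg: "L i t \<ge> 0" for i t
    unfolding L_def by (intro Bochner_Integration.integral_nonneg) (simp add: lyapunov_def)
  have "(\<Sum>t<T. expectation (\<lambda>\<omega>. system_cost S (q t \<omega>) (a t \<omega>)))
      \<le> (\<Sum>t<T. J + (\<Sum>i\<in>storage_phases S. ?B i - (L i (Suc t) - L i t) / V i))"
    unfolding L_def by (intro sum_mono algorithm1_expected_system_cost_le[OF alg J])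
  also have "\<dots> = real T * J + (\<Sum>i\<in>storage_phases S. \<Sum>t<T. ?B i - (L i (Suc t) - L i t) / V i)"
    unfolding sum.distrib by (subst sum.swap) simp
  also have "(\<Sum>i\<in>storage_phases S. \<Sum>t<T. ?B i - (L i (Suc t) - L i t) / V i)
      = (\<Sum>i\<in>storage_phases S. real T * ?B i - (L i T - L i 0) / V i)"
    by (subst sum_subtractf)
       (simp only: sum_divide_distrib[symmetric] sum_lessThan_telescope sum_constant card_lessThan
         times_divide_eq_right)
  also have "\<dots> \<le> (\<Sum>i\<in>storage_phases S. real T * (?B i + L i 0 / (real T * V i)))"
  proof (rule sum_mono)
    fix i assume i: "i \<in> storage_phases S"
    have "(L i 0 - L i T) / V i \<le> L i 0 / V i"
      using L_nonneg[of i T] V_pos[OF i] by (intro divide_right_mono) auto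
    then show "real T * ?B i - (L i T - L i 0) / V i \<le> real T * (?B i + L i 0 / (real T * V i))"
      using T by (simp add: ring_distribs diff_divide_distrib)
  qed
  finally have "(\<Sum>t<T. expectation (\<lambda>\<omega>. system_cost S (q t \<omega>) (a t \<omega>)))
      \<le> real T * (J + (\<Sum>i\<in>storage_phases S. ?B i + L i 0 / (real T * V i)))"
    by (simp add: sum_distrib_left ring_distribs)
  then have "average_cost S M q a T \<le> J + (\<Sum>i\<in>storage_phases S. ?B i + L i 0 / (real T * V i))"
    using T by (simp add: average_cost_def field_simps)
  then show ?thesis by (simp add: L_def)
qed

text \<open>Up to here the optimum was represented by an arbitrary real bound \<open>J\<close> on
  all frozen values. As an extended real it can be \<open>\<infinity>\<close>, when no policy is
  feasible for P1, whereas any single frozen value excludes \<open>-\<infinity>\<close>.\<close>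

lemma algorithm1_near_optimal:
  assumes alg: "algorithm1 S V M s0 q \<xi> a"
  shows "P1_objective S M q a - P1_optimum S M s0 q \<xi>
           \<le> ereal (\<Sum>i\<in>storage_phases S. (u_max S i)\<^sup>2 / (2 * V i))" (is ?asymptotic)
    and "\<forall>T::nat\<ge>1. ereal (average_cost S M q a T) - P1_optimum S M s0 q \<xi>
           \<le> ereal (\<Sum>i\<in>storage_phases S. (u_max S i)\<^sup>2 / (2 * V i)
               + (LINT \<omega>|M. lyapunov S V i (s0 \<omega> $ i)) / (real T * V i))" (is ?finite)
proof -
  let ?opt = "P1_optimum S M s0 q \<xi>"
  have lower: "ereal (expected_slot_value s) \<le> ?opt" for s
    unfolding P1_optimum_def by (intro INF_greatest) (simp add: expected_slot_value_le_P1_objective)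
  have "?asymptotic \<and> ?finite"
  proof (cases ?opt)
    case (real J)
    have J: "expected_slot_value s \<le> J" for s
      using lower[of s] real by simp
    let ?B = "\<Sum>i\<in>storage_phases S. (u_max S i)\<^sup>2 / (2 * V i)"
    \<comment> \<open>\<open>?K\<close> collects the initial Lyapunov terms with
      \<open>1 / T\<close> factored out, so the asymptotic bound is the limit of the finite-horizon
      bounds.\<close>
    let ?K = "\<Sum>i\<in>storage_phases S. expectation (\<lambda>\<omega>. lyapunov S V i (s0 \<omega> $ i)) / V i"
    have "(\<lambda>T. ereal (J + (?B + ?K / real T))) \<longlonglongrightarrow> ereal (J + (?B + 0))"
      by (intro tendsto_ereal tendsto_add tendsto_const lim_const_over_n)
    from lim_imp_Limsup[OF sequentially_bot this]
    have lim: "limsup (\<lambda>T. ereal (J + (?B + ?K / real T))) = ereal (J + ?B)" by simp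
    have "P1_objective S M q a \<le> limsup (\<lambda>T. ereal (J + (?B + ?K / real T)))"
      unfolding P1_objective_def
    proof (intro Limsup_mono eventually_sequentiallyI[of 1])
      fix T :: nat assume "T \<ge> 1"
      from algorithm1_average_cost_le[OF alg J this]
      show "ereal (average_cost S M q a T) \<le> ereal (J + (?B + ?K / real T))"
        by (simp add: sum.distrib sum_divide_distrib mult.commute)
    qed
    then have "P1_objective S M q a \<le> ereal (J + ?B)" by (simp only: lim)
    then have ?asymptotic
      unfolding real by (cases "P1_objective S M q a") auto
    moreover have ?finite
    proof (intro allI impI)
      fix T :: nat assume "T \<ge> 1"
      from algorithm1_average_cost_le[OF alg J this]
      show "ereal (average_cost S M q a T) - ?opt
           \<le> ereal (\<Sum>i\<in>storage_phases S. (u_max S i)\<^sup>2 / (2 * V i)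
               + (LINT \<omega>|M. lyapunov S V i (s0 \<omega> $ i)) / (real T * V i))"
        unfolding real by simp
    qed
    ultimately show ?thesis ..
  next
    case PInf
    \<comment> \<open>In \<open>ereal\<close> the difference
      \<open>\<infinity> - \<infinity>\<close> equals \<open>\<infinity>\<close>, so the objective
      of Algorithm 1 must first be shown to stay below \<open>\<infinity>\<close>. Uniformly bounded
      averages give this, and the difference becomes \<open>-\<infinity>\<close>.\<close>
    obtain C where "\<And>T. \<bar>average_cost S M q a T\<bar> \<le> C"
      using average_cost_bounded[OF algorithm1_slotwise[OF alg]] by blast
    then have "P1_objective S M q a \<le> ereal C"
      unfolding P1_objective_def by (intro Limsup_bounded always_eventually) (auto simp: abs_le_iff)
    then have ?asymptotic
      unfolding PInf by (cases "P1_objective S M q a") auto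
    then show ?thesis unfolding PInf by simp
  next
    case MInf
    then show ?thesis using lower[of 0] by simp
  qed
  then show ?asymptotic ?finite by auto
qed

end

theorem theorem1:
  fixes S :: "('n::finite) network"
    and V :: "'n \<Rightarrow> real"
    and M :: "'w measure"
    and s0 :: "'w \<Rightarrow> real ^ 'n"
    and q :: "nat \<Rightarrow> 'w \<Rightarrow> 'n state"
    and \<xi> :: "nat \<Rightarrow> 'w \<Rightarrow> real"
    and a :: "nat \<Rightarrow> 'w \<Rightarrow> 'n action"
  assumes "CARD('n) \<ge> 2"
    and "flow_set S \<noteq> {}" and "compact (flow_set S)" and "convex (flow_set S)"
    and "\<And>i. convex_on UNIV (ctrl_cost S i)"
    and "\<And>i. ctrl_cost S i C1_differentiable_on UNIV"
    and "\<And>i. i \<in> storage_phases S \<Longrightarrow> convex_on UNIV (storage_cost S i)"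
    and "\<And>i. i \<in> storage_phases S \<Longrightarrow> storage_cost S i C1_differentiable_on UNIV"
    and "convex_on UNIV (deviation_cost S)"
    and "deviation_cost S C1_differentiable_on UNIV"
    and "\<And>i. i \<in> storage_phases S \<Longrightarrow> V_num S i > 0"
    and "\<And>i. i \<in> storage_phases S \<Longrightarrow> V_den S i > 0"
    and "\<And>i. i \<in> storage_phases S \<Longrightarrow> 0 < V i \<and> V i \<le> V_max S i"
    and "random_environment S M s0 q \<xi>"
    and "algorithm1 S V M s0 q \<xi> a"
  shows "P1_objective S M q a - P1_optimum S M s0 q \<xi>
           \<le> ereal (\<Sum>i\<in>storage_phases S. (u_max S i)\<^sup>2 / (2 * V i)) \<and>
         (\<forall>T::nat\<ge>1.
           ereal (average_cost S M q a T) - P1_optimum S M s0 q \<xi>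
             \<le> ereal (\<Sum>i\<in>storage_phases S.
                   (u_max S i)\<^sup>2 / (2 * V i)
                   + (LINT \<omega>|M. lyapunov S V i (s0 \<omega> $ i)) / (real T * V i)))"
proof -
  interpret prob_space M
    using \<open>random_environment S M s0 q \<xi>\<close> by (simp add: random_environment_def)
  \<comment> \<open>The sign of \<open>u_max\<close> comes from the algorithm itself: an almost sure
    event of a probability space has an outcome, and a charging amount between
    \<open>- u_max S i\<close> and \<open>u_max S i\<close> forces \<open>u_max S i \<ge> 0\<close>.
    Zero charging is then admissible, so decisions exist.\<close>
  have "AE \<omega> in M. \<forall>t. P3_solution S V (energy (s0 \<omega>) (\<lambda>k. a k \<omega>) t) (q t \<omega>) (a t \<omega>)"
    using \<open>algorithm1 S V M s0 q \<xi> a\<close> by (simp add: algorithm1_def)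
  from eventually_happens'[OF ae_filter_bot this] obtain \<omega> where
    "P3_solution S V (energy (s0 \<omega>) (\<lambda>k. a k \<omega>) 0) (q 0 \<omega>) (a 0 \<omega>)" by blast
  then have "slot_feasible S (q 0 \<omega>) (a 0 \<omega>)"
    by (simp add: P3_solution_def is_arg_min_def)
  then have u_max: "u_max S i \<ge> 0" if "i \<in> storage_phases S" for i
    using that unfolding slot_feasible_def by force
  interpret storage_control S V M s0 q \<xi>
    by unfold_locales (use assms u_max in \<open>auto intro: C1_differentiable_imp_continuous_on\<close>)
  show ?thesis
    using algorithm1_near_optimal[OF \<open>algorithm1 S V M s0 q \<xi> a\<close>] by blast
qed

end
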